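(* Let $\ell\ge5$ and assume that the simple objects of $\mathcal C_\ell$ are, up to isomorphism, exactly $L(\lambda_0),L(\lambda_1),\dots,L(\lambda_\ell)$. Then every object $M\in\mathcal C_\ell$ has finite length. More precisely, $$\operatorname{length}(M)\le\sum_{i=0}^{\ell}\dim M_{\lambda_i},$$ where $M_{\lambda_i}$ denotes the generalized $\widehat{\mathfrak h}$-weight space of $M$ of weight $\lambda_i$.
   Context: $\mathfrak g$ is the simple complex Lie algebra of type $D_\ell$, $\ell\ge5$, with Cartan subalgebra $\mathfrak h$; $\widehat{\mathfrak g}^{e}=\mathfrak g[t,t^{-1}]\oplus\mathbb C K\oplus\mathbb C d$ is the affine Kac–Moody algebra with $[d,xt^n]=n\,xt^n$, $\widehat{\mathfrak h}=\mathfrak h\oplus\mathbb CK\oplus\mathbb Cd$. $\widehat W$ is its affine Weyl group, $\widehat\rho=h^\vee\Lambda_0+\rho$ with $h^\vee=2\ell-2$ and $\rho$ the half-sum of positive roots of $\mathfrak g$, $w\circ\lambda=w(\lambda+\widehat\rho)-\widehat\rho$, $\widehat Q_+$ is the set of $\mathbb Z_{\ge0}$-combinations of simple roots, and $L(\lambda)$ is the simple highest-weight module. $L_{-1}(D_\ell)$ is the simple affine vertex algebra at level $-1$; on its modules $d$ acts as $-L_0$ with $L_0$ the Sugawara operator. $\mathcal C_\ell$ is the category of $L_{-1}(D_\ell)$-modules $M$ whose underlying $\widehat{\mathfrak g}^e$-module has level $-1$, belongs to the linkage block of $-\Lambda_0$ (irreducible subquotients have highest weights in $\widehat W\circ(-\Lambda_0)$),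 and satisfies: (i) $M$ is the direct sum of its generalized $\widehat{\mathfrak h}$-weight spaces; (ii) each generalized weight space is finite dimensional; (iii) for each $\mu\in\widehat{\mathfrak h}^*$ only finitely many weights in $\mu+\widehat Q_+$ occur in $M$. The Kazhdan–Lusztig left cell $\mathbf c^L(s_0)$ of $\widehat W$ containing the affine simple reflection $s_0$ is known to consist of $\ell+1$ elements $w_0=s_0$ and $w_i=z_is_0$ ($1\le i\le\ell$) with $z_i$ in the finite Weyl group of $\mathfrak g$. Put $\mu_0=0$, $\mu_i=z_i\rho-\rho$, and $\lambda_i=w_i\circ(-\Lambda_0)=-\Lambda_0+\mu_i\in\widehat{\mathfrak h}^*$, where $\lambda_i(d)=0$. *)

theory Defs
  imports
    Complex_Main
    "HOL-Library.Groups_Big_Fun"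
    "HOL-Library.Function_Algebras"
    "HOL-Library.Product_Plus"
    "HOL-Library.Extended_Nat"
    "HOL-Computational_Algebra.Polynomial"
    "Jordan_Normal_Form.Matrix"
begin

section \<open>Complex vector spaces\<close>

class complex_vector = ab_group_add +
  fixes scaleC :: "complex \<Rightarrow> 'a \<Rightarrow> 'a"  (infixr "*\<^sub>C" 75)
  assumes scaleC_add_right: "a *\<^sub>C (x + y) = a *\<^sub>C x + a *\<^sub>C y"
    and scaleC_add_left: "(a + b) *\<^sub>C x = a *\<^sub>C x + b *\<^sub>C x"
    and scaleC_scaleC: "a *\<^sub>C (b *\<^sub>C x) = (a * b) *\<^sub>C x"
    and scaleC_one: "1 *\<^sub>C x = x"

interpretation cvs: vector_space "scaleC :: complex \<Rightarrow> 'a \<Rightarrow> 'a::complex_vector"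
  by standard (simp_all add: scaleC_add_right scaleC_add_left scaleC_scaleC scaleC_one)

instantiation complex :: complex_vector
begin
definition scaleC_complex :: "complex \<Rightarrow> complex \<Rightarrow> complex"
  where "scaleC_complex a x = a * x"
instance by standard (simp_all add: scaleC_complex_def algebra_simps)
end

instantiation "fun" :: (type, complex_vector) complex_vector
begin
definition scaleC_fun :: "complex \<Rightarrow> ('a \<Rightarrow> 'b) \<Rightarrow> 'a \<Rightarrow> 'b"
  where "scaleC_fun a f = (\<lambda>x. a *\<^sub>C f x)"
instance
  by standard (auto simp: scaleC_fun_def fun_eq_iff plus_fun_def
      scaleC_add_right scaleC_add_left scaleC_scaleC scaleC_one)
end

instantiation prod :: (complex_vector, complex_vector) complex_vector
begin
definition scaleC_prod :: "complex \<Rightarrow> 'a \<times> 'b \<Rightarrow> 'a \<times> 'b"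
  where "scaleC_prod a p = (a *\<^sub>C fst p, a *\<^sub>C snd p)"
instance
  by standard (auto simp: scaleC_prod_def plus_prod_def
      scaleC_add_right scaleC_add_left scaleC_scaleC scaleC_one)
end


section \<open>The simple Lie algebra of type D\<close>

text \<open>The Lie algebra of type \<open>D\<close> and rank \<open>l\<close> is realised as \<open>so(2l)\<close>, the matrices
  that are skew for the split symmetric form pairing \<open>e_i\<close> with \<open>e_(i+l)\<close>.  The Cartan
  subalgebra consists of the matrices \<open>diag (a_0, ..., a_(l-1), -a_0, ..., -a_(l-1))\<close>, and
  \<open>\<epsilon>_i\<close> is the functional reading off \<open>a_i\<close>; indices start at \<open>0\<close>.\<close>

definition Jmat :: "nat \<Rightarrow> complex mat" where
  "Jmat l = mat (2*l) (2*l) (\<lambda>(i,j). if i = j + l \<or> j = i + l then 1 else 0)"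

definition so_alg :: "nat \<Rightarrow> complex mat set" where
  "so_alg l = {A \<in> carrier_mat (2*l) (2*l).
     transpose_mat A * Jmat l + Jmat l * A = 0\<^sub>m (2*l) (2*l)}"

definition lie :: "complex mat \<Rightarrow> complex mat \<Rightarrow> complex mat" where
  "lie A B = A * B - B * A"

text \<open>Half the trace form: the invariant form for which the roots have square length 2.\<close>

definition inv_form :: "nat \<Rightarrow> complex mat \<Rightarrow> complex mat \<Rightarrow> complex" where
  "inv_form l A B = (\<Sum>i<2*l. (A * B) $$ (i,i)) / 2"

definition cartan :: "nat \<Rightarrow> complex mat set" where
  "cartan l = {A \<in> so_alg l. diagonal_mat A}"

definition dual_coxeter :: "nat \<Rightarrow> complex" where
  "dual_coxeter l = 2 * of_nat l - 2"

definition eps :: "nat \<Rightarrow> nat \<Rightarrow> complex" where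
  "eps i = (\<lambda>j. if j = i then 1 else 0)"

definition pos_roots :: "nat \<Rightarrow> (nat \<Rightarrow> complex) set" where
  "pos_roots l = {eps i - eps j |i j. i < j \<and> j < l} \<union> {eps i + eps j |i j. i < j \<and> j < l}"

definition rho_fin :: "nat \<Rightarrow> nat \<Rightarrow> complex" where
  "rho_fin l = (1/2) *\<^sub>C (\<Sum>\<alpha>\<in>pos_roots l. \<alpha>)"

definition root_space :: "nat \<Rightarrow> (nat \<Rightarrow> complex) \<Rightarrow> complex mat set" where
  "root_space l \<alpha> = {A \<in> so_alg l. \<forall>H\<in>cartan l. lie H A = (\<Sum>i<l. \<alpha> i * H $$ (i,i)) \<cdot>\<^sub>m A}"


section \<open>Affine weights\<close>

text \<open>The triple \<open>(f, c, e)\<close> stands for \<open>(\<Sum>i<l. f i \<epsilon>_i) + c \<Lambda>_0 + e \<delta>\<close>, that is, the functional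
  on \<open>\<hh> \<oplus> \<complex>K \<oplus> \<complex>d\<close> with values \<open>f\<close> on the Cartan subalgebra, \<open>c\<close> on \<open>K\<close> and \<open>e\<close> on \<open>d\<close>.\<close>

type_synonym aweight = "(nat \<Rightarrow> complex) \<times> complex \<times> complex"

definition hdual :: "nat \<Rightarrow> aweight set" where
  "hdual l = {(f, c, e) |f c e. \<forall>i\<ge>l. f i = 0}"

definition weval :: "nat \<Rightarrow> aweight \<Rightarrow> complex mat \<Rightarrow> complex \<Rightarrow> complex \<Rightarrow> complex" where
  "weval l \<nu> H a b =
     (case \<nu> of (f, c, e) \<Rightarrow> (\<Sum>i<l. f i * H $$ (i,i)) + a * c + b * e)"

definition wform :: "nat \<Rightarrow> aweight \<Rightarrow> aweight \<Rightarrow> complex" where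
  "wform l \<nu> \<mu> = (case \<nu> of (f, c, e) \<Rightarrow> case \<mu> of (f', c', e') \<Rightarrow>
     (\<Sum>i<l. f i * f' i) + c * e' + e * c')"

definition Lambda0 :: aweight where "Lambda0 = (0, 1, 0)"

text \<open>\<open>\<alpha>_0 = \<delta> - \<theta>\<close> with \<open>\<theta> = \<epsilon>_0 + \<epsilon>_1\<close> the highest root.\<close>

definition simple_root :: "nat \<Rightarrow> nat \<Rightarrow> aweight" where
  "simple_root l i =
     (if i = 0 then (- (eps 0 + eps 1), 0, 1)
      else if i = l then (eps (l - 2) + eps (l - 1), 0, 0)
      else (eps (i - 1) - eps i, 0, 0))"

definition wreflect :: "nat \<Rightarrow> aweight \<Rightarrow> aweight \<Rightarrow> aweight" where
  "wreflect l \<alpha> \<nu> = \<nu> - (2 * wform l \<nu> \<alpha> / wform l \<alpha> \<alpha>) *\<^sub>C \<alpha>"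

definition simple_refl :: "nat \<Rightarrow> nat \<Rightarrow> aweight \<Rightarrow> aweight" where
  "simple_refl l i = wreflect l (simple_root l i)"

definition rho_hat :: "nat \<Rightarrow> aweight" where
  "rho_hat l = (rho_fin l, dual_coxeter l, 0)"

definition dot_act :: "nat \<Rightarrow> (aweight \<Rightarrow> aweight) \<Rightarrow> aweight \<Rightarrow> aweight" where
  "dot_act l w \<nu> = w (\<nu> + rho_hat l) - rho_hat l"

definition Q_plus :: "nat \<Rightarrow> aweight set" where
  "Q_plus l = {\<Sum>i\<le>l. of_nat (n i) *\<^sub>C simple_root l i |n :: nat \<Rightarrow> nat. True}"


section \<open>Coxeter groups and Kazhdan--Lusztig left cells\<close>

text \<open>A Coxeter group is given by a set \<open>S\<close> of simple reflections acting faithfully on some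
  type; its elements are the finite compositions.\<close>

definition cox_word :: "('a \<Rightarrow> 'a) list \<Rightarrow> 'a \<Rightarrow> 'a" where
  "cox_word ws = foldr (\<circ>) ws id"

definition cox_group :: "('a \<Rightarrow> 'a) set \<Rightarrow> ('a \<Rightarrow> 'a) set" where
  "cox_group S = {cox_word ws |ws. set ws \<subseteq> S}"

definition cox_len :: "('a \<Rightarrow> 'a) set \<Rightarrow> ('a \<Rightarrow> 'a) \<Rightarrow> nat" where
  "cox_len S w = (LEAST n. \<exists>ws. set ws \<subseteq> S \<and> length ws = n \<and> cox_word ws = w)"

definition cox_reflections :: "('a \<Rightarrow> 'a) set \<Rightarrow> ('a \<Rightarrow> 'a) set" where
  "cox_reflections S = {x \<circ> s \<circ> inv_into UNIV x |x s. x \<in> cox_group S \<and> s \<in> S}"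

definition bruhat_step :: "('a \<Rightarrow> 'a) set \<Rightarrow> ('a \<Rightarrow> 'a) \<Rightarrow> ('a \<Rightarrow> 'a) \<Rightarrow> bool" where
  "bruhat_step S x y \<longleftrightarrow> x \<in> cox_group S \<and> y \<in> cox_group S \<and>
     (\<exists>t\<in>cox_reflections S. y = x \<circ> t) \<and> cox_len S x < cox_len S y"

definition bruhat_le :: "('a \<Rightarrow> 'a) set \<Rightarrow> ('a \<Rightarrow> 'a) \<Rightarrow> ('a \<Rightarrow> 'a) \<Rightarrow> bool" where
  "bruhat_le S x y \<longleftrightarrow> x \<in> cox_group S \<and> y \<in> cox_group S \<and> (bruhat_step S)\<^sup>*\<^sup>* x y"

definition left_descents :: "('a \<Rightarrow> 'a) set \<Rightarrow> ('a \<Rightarrow> 'a) \<Rightarrow> ('a \<Rightarrow> 'a) set" where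
  "left_descents S w = {s \<in> S. cox_len S (s \<circ> w) < cox_len S w}"

definition right_descents :: "('a \<Rightarrow> 'a) set \<Rightarrow> ('a \<Rightarrow> 'a) \<Rightarrow> ('a \<Rightarrow> 'a) set" where
  "right_descents S w = {s \<in> S. cox_len S (w \<circ> s) < cox_len S w}"

text \<open>The \<open>R\<close>-polynomials and the Kazhdan--Lusztig polynomials are the unique families with the
  following properties; the indeterminate \<open>q\<close> is \<open>[:0, 1:]\<close>.  Both families are set to zero
  outside the group, so that \<open>THE\<close> is meaningful on the function type.\<close>

definition is_R_family ::
  "('a \<Rightarrow> 'a) set \<Rightarrow> (('a \<Rightarrow> 'a) \<Rightarrow> ('a \<Rightarrow> 'a) \<Rightarrow> int poly) \<Rightarrow> bool" where
  "is_R_family S R \<longleftrightarrow>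
     (\<forall>u v. \<not> bruhat_le S u v \<longrightarrow> R u v = 0) \<and>
     (\<forall>u\<in>cox_group S. R u u = 1) \<and>
     (\<forall>u\<in>cox_group S. \<forall>v\<in>cox_group S. \<forall>s\<in>right_descents S v.
        R u v = (if s \<in> right_descents S u then R (u \<circ> s) (v \<circ> s)
                 else [:0, 1:] * R (u \<circ> s) (v \<circ> s) + [:-1, 1:] * R u (v \<circ> s)))"

definition R_poly :: "('a \<Rightarrow> 'a) set \<Rightarrow> ('a \<Rightarrow> 'a) \<Rightarrow> ('a \<Rightarrow> 'a) \<Rightarrow> int poly" where
  "R_poly S = (THE R. is_R_family S R)"

text \<open>The left-hand side of the last condition is \<open>q^n P u v (1/q)\<close> for
  \<open>n = cox_len S v - cox_len S u\<close>.\<close>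

definition is_KL_family ::
  "('a \<Rightarrow> 'a) set \<Rightarrow> (('a \<Rightarrow> 'a) \<Rightarrow> ('a \<Rightarrow> 'a) \<Rightarrow> int poly) \<Rightarrow> bool" where
  "is_KL_family S P \<longleftrightarrow>
     (\<forall>u v. \<not> bruhat_le S u v \<longrightarrow> P u v = 0) \<and>
     (\<forall>u\<in>cox_group S. P u u = 1) \<and>
     (\<forall>u v. bruhat_le S u v \<and> u \<noteq> v \<longrightarrow>
        2 * degree (P u v) + 1 \<le> cox_len S v - cox_len S u) \<and>
     (\<forall>u v. bruhat_le S u v \<longrightarrow>
        (\<Sum>i\<le>cox_len S v - cox_len S u.
            monom (coeff (P u v) i) (cox_len S v - cox_len S u - i)) =
        (\<Sum>a | bruhat_le S u a \<and> bruhat_le S a v. R_poly S u a * P a v))"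

definition KL_poly :: "('a \<Rightarrow> 'a) set \<Rightarrow> ('a \<Rightarrow> 'a) \<Rightarrow> ('a \<Rightarrow> 'a) \<Rightarrow> int poly" where
  "KL_poly S = (THE P. is_KL_family S P)"

definition KL_prec :: "('a \<Rightarrow> 'a) set \<Rightarrow> ('a \<Rightarrow> 'a) \<Rightarrow> ('a \<Rightarrow> 'a) \<Rightarrow> bool" where
  "KL_prec S u v \<longleftrightarrow> bruhat_le S u v \<and> u \<noteq> v \<and> odd (cox_len S v - cox_len S u) \<and>
     coeff (KL_poly S u v) ((cox_len S v - cox_len S u - 1) div 2) \<noteq> 0"

text \<open>One step \<open>x \<le>\<^sub>L y\<close> of the Kazhdan--Lusztig left preorder: \<open>x\<close> and \<open>y\<close> are joined in the
  W-graph and the left descent set of \<open>x\<close> is not contained in that of \<open>y\<close>.\<close>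

definition left_step :: "('a \<Rightarrow> 'a) set \<Rightarrow> ('a \<Rightarrow> 'a) \<Rightarrow> ('a \<Rightarrow> 'a) \<Rightarrow> bool" where
  "left_step S x y \<longleftrightarrow> (KL_prec S x y \<or> KL_prec S y x) \<and>
     \<not> left_descents S x \<subseteq> left_descents S y"

definition left_cell :: "('a \<Rightarrow> 'a) set \<Rightarrow> ('a \<Rightarrow> 'a) \<Rightarrow> ('a \<Rightarrow> 'a) set" where
  "left_cell S x = {y \<in> cox_group S. (left_step S)\<^sup>*\<^sup>* x y \<and> (left_step S)\<^sup>*\<^sup>* y x}"

definition affine_gens :: "nat \<Rightarrow> (aweight \<Rightarrow> aweight) set" where
  "affine_gens l = simple_refl l ` {0..l}"

definition finite_gens :: "nat \<Rightarrow> (aweight \<Rightarrow> aweight) set" where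
  "finite_gens l = simple_refl l ` {1..l}"

abbreviation affine_weyl :: "nat \<Rightarrow> (aweight \<Rightarrow> aweight) set" where
  "affine_weyl l \<equiv> cox_group (affine_gens l)"

abbreviation finite_weyl :: "nat \<Rightarrow> (aweight \<Rightarrow> aweight) set" where
  "finite_weyl l \<equiv> cox_group (finite_gens l)"


section \<open>Modules over the affine Lie algebra\<close>

text \<open>A representation of \<open>\<gg>[t,1/t] \<oplus> \<complex>K \<oplus> \<complex>d\<close> is given by the operators \<open>loop x n\<close> of \<open>x t^n\<close>,
  \<open>cent\<close> of \<open>K\<close> and \<open>der\<close> of \<open>d\<close>.  Modules live on subspaces of an ambient vector space, so
  that submodules and (via linear complements) quotients stay within the same type; the
  operators are irrelevant outside the carrier.\<close>

record 'm affine_mod =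
  acar :: "'m set"
  loop :: "complex mat \<Rightarrow> int \<Rightarrow> 'm \<Rightarrow> 'm"
  cent :: "'m \<Rightarrow> 'm"
  der :: "'m \<Rightarrow> 'm"

definition linear_on :: "'m::complex_vector set \<Rightarrow> ('m \<Rightarrow> 'n::complex_vector) \<Rightarrow> bool" where
  "linear_on A f \<longleftrightarrow> (\<forall>u\<in>A. \<forall>v\<in>A. f (u + v) = f u + f v) \<and> (\<forall>c. \<forall>v\<in>A. f (c *\<^sub>C v) = c *\<^sub>C f v)"

definition affine_module :: "nat \<Rightarrow> 'm::complex_vector affine_mod \<Rightarrow> bool" where
  "affine_module l M \<longleftrightarrow>
     cvs.subspace (acar M) \<and>
     (\<forall>x\<in>so_alg l. \<forall>n. loop M x n ` acar M \<subseteq> acar M \<and> linear_on (acar M) (loop M x n)) \<and>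
     cent M ` acar M \<subseteq> acar M \<and> linear_on (acar M) (cent M) \<and>
     der M ` acar M \<subseteq> acar M \<and> linear_on (acar M) (der M) \<and>
     (\<forall>v\<in>acar M.
        (\<forall>x\<in>so_alg l. \<forall>y\<in>so_alg l. \<forall>n. loop M (x + y) n v = loop M x n v + loop M y n v) \<and>
        (\<forall>c. \<forall>x\<in>so_alg l. \<forall>n. loop M (c \<cdot>\<^sub>m x) n v = c *\<^sub>C loop M x n v) \<and>
        (\<forall>x\<in>so_alg l. \<forall>y\<in>so_alg l. \<forall>m n.
           loop M x m (loop M y n v) - loop M y n (loop M x m v) =
             loop M (lie x y) (m + n) v
             + (if m + n = 0 then (of_int m * inv_form l x y) *\<^sub>C cent M v else 0)) \<and>
        (\<forall>x\<in>so_alg l. \<forall>n. cent M (loop M x n v) = loop M x n (cent M v)) \<and>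
        (\<forall>x\<in>so_alg l. \<forall>n.
           der M (loop M x n v) - loop M x n (der M v) = of_int n *\<^sub>C loop M x n v) \<and>
        cent M (der M v) = der M (cent M v))"

definition affine_submodule :: "nat \<Rightarrow> 'm::complex_vector affine_mod \<Rightarrow> 'm set \<Rightarrow> bool" where
  "affine_submodule l M U \<longleftrightarrow> cvs.subspace U \<and> U \<subseteq> acar M \<and>
     (\<forall>x\<in>so_alg l. \<forall>n. loop M x n ` U \<subseteq> U) \<and> cent M ` U \<subseteq> U \<and> der M ` U \<subseteq> U"

definition affine_irreducible :: "nat \<Rightarrow> 'm::complex_vector affine_mod \<Rightarrow> bool" where
  "affine_irreducible l M \<longleftrightarrow> affine_module l M \<and> acar M \<noteq> {0} \<and>
     (\<forall>U. affine_submodule l M U \<longrightarrow> U = {0} \<or> U = acar M)"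

text \<open>\<open>S\<close> is isomorphic to a subquotient of \<open>M\<close>: the image of a submodule of \<open>M\<close> under a
  homomorphism.\<close>

definition affine_subquotient ::
  "nat \<Rightarrow> 'm::complex_vector affine_mod \<Rightarrow> 'n::complex_vector affine_mod \<Rightarrow> bool" where
  "affine_subquotient l M S \<longleftrightarrow> affine_module l S \<and>
     (\<exists>U f. affine_submodule l M U \<and> linear_on U f \<and> f ` U = acar S \<and>
        (\<forall>u\<in>U. (\<forall>x\<in>so_alg l. \<forall>n. f (loop M x n u) = loop S x n (f u)) \<and>
                f (cent M u) = cent S (f u) \<and> f (der M u) = der S (f u)))"

definition cartan_op ::
  "'m::complex_vector affine_mod \<Rightarrow> complex mat \<Rightarrow> complex \<Rightarrow> complex \<Rightarrow> 'm \<Rightarrow> 'm" where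
  "cartan_op M H a b v = loop M H 0 v + a *\<^sub>C cent M v + b *\<^sub>C der M v"

definition gen_weight_space ::
  "nat \<Rightarrow> 'm::complex_vector affine_mod \<Rightarrow> aweight \<Rightarrow> 'm set" where
  "gen_weight_space l M \<nu> = {v \<in> acar M. \<forall>H\<in>cartan l. \<forall>a b. \<exists>n.
     ((\<lambda>u. cartan_op M H a b u - weval l \<nu> H a b *\<^sub>C u) ^^ n) v = 0}"

definition is_hw_vector ::
  "nat \<Rightarrow> 'm::complex_vector affine_mod \<Rightarrow> aweight \<Rightarrow> 'm \<Rightarrow> bool" where
  "is_hw_vector l M \<nu> v \<longleftrightarrow> v \<in> acar M \<and> v \<noteq> 0 \<and>
     (\<forall>H\<in>cartan l. \<forall>a b. cartan_op M H a b v = weval l \<nu> H a b *\<^sub>C v) \<and>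
     (\<forall>\<alpha>\<in>pos_roots l. \<forall>x\<in>root_space l \<alpha>. loop M x 0 v = 0) \<and>
     (\<forall>x\<in>so_alg l. \<forall>n>0. loop M x n v = 0)"

text \<open>\<open>M\<close> is (isomorphic to) the simple highest-weight module \<open>L(\<nu>)\<close>.\<close>

definition is_L :: "nat \<Rightarrow> aweight \<Rightarrow> 'm::complex_vector affine_mod \<Rightarrow> bool" where
  "is_L l \<nu> M \<longleftrightarrow> affine_irreducible l M \<and> (\<exists>v. is_hw_vector l M \<nu> v)"


section \<open>Vertex algebras and their modules\<close>

text \<open>\<open>nprod V a n b\<close> is the \<open>n\<close>-th product \<open>a_(n) b\<close>, the coefficient of \<open>z^(-n-1)\<close> in
  \<open>Y(a,z) b\<close>; similarly \<open>mprod\<close> for modules.\<close>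

record 'v vertex_alg =
  vac :: 'v
  nprod :: "'v \<Rightarrow> int \<Rightarrow> 'v \<Rightarrow> 'v"

record ('v, 'm) vmod =
  vcar :: "'m set"
  mprod :: "'v \<Rightarrow> int \<Rightarrow> 'm \<Rightarrow> 'm"

text \<open>The sums in the Borcherds identity have finite support by the field axiom
  (\<open>vertex_module\<close> and \<open>vertex_algebra\<close> below), so that \<open>Sum_any\<close> is the intended sum.\<close>

definition borcherds_at ::
  "'v::complex_vector vertex_alg \<Rightarrow> ('v \<Rightarrow> int \<Rightarrow> 'm::complex_vector \<Rightarrow> 'm) \<Rightarrow> 'm \<Rightarrow> bool" where
  "borcherds_at V Y c \<longleftrightarrow> (\<forall>a b. \<forall>m n k :: int.
     Sum_any (\<lambda>j::nat. (of_int m gchoose j) *\<^sub>C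
        Y (nprod V a (n + int j) b) (m + k - int j) c) =
     Sum_any (\<lambda>j::nat. ((-1) ^ j * (of_int n gchoose j)) *\<^sub>C
        (Y a (m + n - int j) (Y b (k + int j) c)
         - ((-1) powi n) *\<^sub>C Y b (n + k - int j) (Y a (m + int j) c))))"

definition vertex_module ::
  "'v::complex_vector vertex_alg \<Rightarrow> ('v, 'm::complex_vector) vmod \<Rightarrow> bool" where
  "vertex_module V M \<longleftrightarrow>
     cvs.subspace (vcar M) \<and>
     (\<forall>a n. mprod M a n ` vcar M \<subseteq> vcar M \<and> linear_on (vcar M) (mprod M a n)) \<and>
     (\<forall>n. \<forall>v\<in>vcar M. linear_on UNIV (\<lambda>a. mprod M a n v)) \<and>
     (\<forall>a. \<forall>v\<in>vcar M. \<exists>N. \<forall>n\<ge>N. mprod M a n v = 0) \<and>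
     (\<forall>n. \<forall>v\<in>vcar M. mprod M (vac V) n v = (if n = -1 then v else 0)) \<and>
     (\<forall>v\<in>vcar M. borcherds_at V (mprod M) v)"

text \<open>A vertex algebra is a module over itself that satisfies the creation axiom.\<close>

definition vertex_algebra :: "'v::complex_vector vertex_alg \<Rightarrow> bool" where
  "vertex_algebra V \<longleftrightarrow>
     vertex_module V \<lparr>vcar = UNIV, mprod = nprod V\<rparr> \<and>
     (\<forall>a. nprod V a (-1) (vac V) = a \<and> (\<forall>n\<ge>0. nprod V a n (vac V) = 0))"

definition va_ideal :: "'v::complex_vector vertex_alg \<Rightarrow> 'v set \<Rightarrow> bool" where
  "va_ideal V I \<longleftrightarrow> cvs.subspace I \<and> (\<forall>a n. \<forall>b\<in>I. nprod V a n b \<in> I \<and> nprod V b n a \<in> I)"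

definition va_simple :: "'v::complex_vector vertex_alg \<Rightarrow> bool" where
  "va_simple V \<longleftrightarrow> (UNIV :: 'v set) \<noteq> {0} \<and> (\<forall>I. va_ideal V I \<longrightarrow> I = {0} \<or> I = UNIV)"

text \<open>\<open>V\<close> together with \<open>\<iota> : \<gg> \<rightarrow> V\<close> (the map \<open>x \<mapsto> x t^(-1) |0>\<close>) is an affine vertex algebra of
  level \<open>k\<close>: it is generated by \<open>\<iota> \<gg>\<close>, with the operator products of the currents.
  Up to isomorphism these are the quotients of the universal affine vertex
  algebra of level \<open>k\<close>.  If \<open>k\<close> is not critical, every ideal is stable under \<open>L_0\<close>, hence graded, and
  so there is a unique simple one, the simple affine vertex algebra of level \<open>k\<close>.\<close>

definition affine_vertex_algebra ::
  "nat \<Rightarrow> complex \<Rightarrow> 'v::complex_vector vertex_alg \<Rightarrow> (complex mat \<Rightarrow> 'v) \<Rightarrow> bool" where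
  "affine_vertex_algebra l k V \<iota> \<longleftrightarrow>
     vertex_algebra V \<and>
     (\<forall>x\<in>so_alg l. \<forall>y\<in>so_alg l. \<iota> (x + y) = \<iota> x + \<iota> y) \<and>
     (\<forall>c. \<forall>x\<in>so_alg l. \<iota> (c \<cdot>\<^sub>m x) = c *\<^sub>C \<iota> x) \<and>
     (\<forall>x\<in>so_alg l. \<forall>y\<in>so_alg l.
        nprod V (\<iota> x) 0 (\<iota> y) = \<iota> (lie x y) \<and>
        nprod V (\<iota> x) 1 (\<iota> y) = (k * inv_form l x y) *\<^sub>C vac V \<and>
        (\<forall>n\<ge>2. nprod V (\<iota> x) n (\<iota> y) = 0)) \<and>
     (\<forall>U. cvs.subspace U \<and> vac V \<in> U \<and> \<iota> ` so_alg l \<subseteq> U \<and>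
        (\<forall>a\<in>U. \<forall>b\<in>U. \<forall>n. nprod V a n b \<in> U) \<longrightarrow> U = UNIV)"

definition simple_affine_vertex_algebra ::
  "nat \<Rightarrow> complex \<Rightarrow> 'v::complex_vector vertex_alg \<Rightarrow> (complex mat \<Rightarrow> 'v) \<Rightarrow> bool" where
  "simple_affine_vertex_algebra l k V \<iota> \<longleftrightarrow> affine_vertex_algebra l k V \<iota> \<and> va_simple V"

text \<open>The matrix \<open>so_gen l i j\<close> is \<open>E_(i,j) - E_(j',i')\<close>, where \<open>i' = i \<plusminus> l\<close> is the index paired
  with \<open>i\<close>.  It equals \<open>- so_gen l j' i'\<close>, and removing this redundancy (and \<open>so_gen l i i' = 0\<close>)
  leaves a basis of \<open>so(2l)\<close> in which \<open>so_gen l j i\<close> is dual to \<open>so_gen l i j\<close> for \<open>inv_form\<close>.  In the double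
  sum of the Sugawara vector each basis element is counted twice, so the usual factor
  \<open>1 / (2 (k + dual_coxeter l))\<close> becomes \<open>1 / (4 (k + dual_coxeter l))\<close>.\<close>

definition opp_index :: "nat \<Rightarrow> nat \<Rightarrow> nat" where
  "opp_index l i = (if i < l then i + l else i - l)"

definition so_gen :: "nat \<Rightarrow> nat \<Rightarrow> nat \<Rightarrow> complex mat" where
  "so_gen l i j = mat (2*l) (2*l) (\<lambda>(p,r).
     (if p = i \<and> r = j then 1 else 0) - (if p = opp_index l j \<and> r = opp_index l i then 1 else 0))"

definition sugawara ::
  "nat \<Rightarrow> complex \<Rightarrow> 'v::complex_vector vertex_alg \<Rightarrow> (complex mat \<Rightarrow> 'v) \<Rightarrow> 'v" where
  "sugawara l k V \<iota> = (1 / (4 * (k + dual_coxeter l))) *\<^sub>C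
     (\<Sum>i<2*l. \<Sum>j<2*l. nprod V (\<iota> (so_gen l i j)) (-1) (\<iota> (so_gen l j i)))"

text \<open>The underlying module of the affine Lie algebra: \<open>x t^n\<close> acts as the \<open>n\<close>-th mode of \<open>\<iota> x\<close>,
  \<open>K\<close> as the level and \<open>d\<close> as \<open>- L_0\<close>, where \<open>L_0\<close> is the mode of index \<open>1\<close> of the Sugawara vector.\<close>

definition underlying ::
  "nat \<Rightarrow> complex \<Rightarrow> 'v::complex_vector vertex_alg \<Rightarrow> (complex mat \<Rightarrow> 'v) \<Rightarrow>
   ('v, 'm::complex_vector) vmod \<Rightarrow> 'm affine_mod" where
  "underlying l k V \<iota> M =
     \<lparr>acar = vcar M,
      loop = (\<lambda>x n. mprod M (\<iota> x) n),
      cent = (\<lambda>v. k *\<^sub>C v),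
      der = (\<lambda>v. - mprod M (sugawara l k V \<iota>) 1 v)\<rparr>"

definition vsubmodule ::
  "'v::complex_vector vertex_alg \<Rightarrow> ('v, 'm::complex_vector) vmod \<Rightarrow> 'm set \<Rightarrow> bool" where
  "vsubmodule V M U \<longleftrightarrow> cvs.subspace U \<and> U \<subseteq> vcar M \<and> (\<forall>a n. mprod M a n ` U \<subseteq> U)"

definition vmod_simple ::
  "'v::complex_vector vertex_alg \<Rightarrow> ('v, 'm::complex_vector) vmod \<Rightarrow> bool" where
  "vmod_simple V M \<longleftrightarrow> vcar M \<noteq> {0} \<and> (\<forall>U. vsubmodule V M U \<longrightarrow> U = {0} \<or> U = vcar M)"

definition submodule_chain ::
  "'v::complex_vector vertex_alg \<Rightarrow> ('v, 'm::complex_vector) vmod \<Rightarrow> nat \<Rightarrow> (nat \<Rightarrow> 'm set) \<Rightarrow> bool"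
  where
  "submodule_chain V M n C \<longleftrightarrow> C 0 = {0} \<and> C n = vcar M \<and>
     (\<forall>i\<le>n. vsubmodule V M (C i)) \<and> (\<forall>i<n. C i \<subset> C (Suc i))"

text \<open>Finite length: there is a finite composition series, i.e. a chain without
  proper refinement (the factors \<open>C (i+1) / C i\<close> are simple).\<close>

definition finite_length ::
  "'v::complex_vector vertex_alg \<Rightarrow> ('v, 'm::complex_vector) vmod \<Rightarrow> bool" where
  "finite_length V M \<longleftrightarrow> (\<exists>n C. submodule_chain V M n C \<and>
     (\<forall>i<n. \<forall>U. vsubmodule V M U \<and> C i \<subseteq> U \<and> U \<subseteq> C (Suc i) \<longrightarrow> U = C i \<or> U = C (Suc i)))"

text \<open>The length, as the supremum of the lengths of all chains of submodules; it is
  the length of any composition series if there is one and infinite otherwise.\<close>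

definition vmod_length ::
  "'v::complex_vector vertex_alg \<Rightarrow> ('v, 'm::complex_vector) vmod \<Rightarrow> enat" where
  "vmod_length V M = Sup {enat n |n. \<exists>C. submodule_chain V M n C}"


section \<open>The category\<close>

text \<open>Every irreducible subquotient has its highest weight in the dot orbit of \<open>\<nu>\<close> under the
  affine Weyl group.\<close>

definition in_linkage_block :: "nat \<Rightarrow> aweight \<Rightarrow> 'm::complex_vector affine_mod \<Rightarrow> bool" where
  "in_linkage_block l \<nu> M \<longleftrightarrow> (\<forall>S :: 'm affine_mod.
     affine_subquotient l M S \<and> affine_irreducible l S \<longrightarrow>
     (\<exists>w\<in>affine_weyl l. is_L l (dot_act l w \<nu>) S))"

definition gen_weight_decomposed :: "nat \<Rightarrow> 'm::complex_vector affine_mod \<Rightarrow> bool" where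
  "gen_weight_decomposed l M \<longleftrightarrow> (\<forall>v\<in>acar M. \<exists>!f :: aweight \<Rightarrow> 'm.
     (\<forall>\<nu>\<in>hdual l. f \<nu> \<in> gen_weight_space l M \<nu>) \<and> (\<forall>\<nu>. \<nu> \<notin> hdual l \<longrightarrow> f \<nu> = 0) \<and>
     finite {\<nu>. f \<nu> \<noteq> 0} \<and> v = (\<Sum>\<nu> | f \<nu> \<noteq> 0. f \<nu>))"

definition gen_weights_finite_dim :: "nat \<Rightarrow> 'm::complex_vector affine_mod \<Rightarrow> bool" where
  "gen_weights_finite_dim l M \<longleftrightarrow> (\<forall>\<nu>\<in>hdual l.
     \<exists>B. finite B \<and> gen_weight_space l M \<nu> = cvs.span B)"

definition gen_weights_bounded :: "nat \<Rightarrow> 'm::complex_vector affine_mod \<Rightarrow> bool" where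
  "gen_weights_bounded l M \<longleftrightarrow> (\<forall>\<mu>\<in>hdual l.
     finite {\<nu>. \<nu> - \<mu> \<in> Q_plus l \<and> gen_weight_space l M \<nu> \<noteq> {0}})"

definition category_C ::
  "nat \<Rightarrow> 'v::complex_vector vertex_alg \<Rightarrow> (complex mat \<Rightarrow> 'v) \<Rightarrow>
   ('v, 'm::complex_vector) vmod \<Rightarrow> bool" where
  "category_C l V \<iota> M \<longleftrightarrow> vertex_module V M \<and>
     (let N = underlying l (-1) V \<iota> M in
        in_linkage_block l (- Lambda0) N \<and>
        gen_weight_decomposed l N \<and>
        gen_weights_finite_dim l N \<and>
        gen_weights_bounded l N)"

text \<open>Up to isomorphism, the simple objects of the category living on subspaces of the
  type \<open>'m\<close> are exactly the modules \<open>L(\<nu>)\<close> with \<open>\<nu> \<in> X\<close>.\<close>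

definition simple_objects_are ::
  "'m::complex_vector itself \<Rightarrow> nat \<Rightarrow> 'v::complex_vector vertex_alg \<Rightarrow>
   (complex mat \<Rightarrow> 'v) \<Rightarrow> aweight set \<Rightarrow> bool" where
  "simple_objects_are _ l V \<iota> X \<longleftrightarrow>
     (\<forall>N :: ('v, 'm) vmod. category_C l V \<iota> N \<and> vmod_simple V N \<longrightarrow>
        (\<exists>\<nu>\<in>X. is_L l \<nu> (underlying l (-1) V \<iota> N))) \<and>
     (\<forall>\<nu>\<in>X. \<exists>N :: ('v, 'm) vmod. category_C l V \<iota> N \<and> vmod_simple V N \<and>
        is_L l \<nu> (underlying l (-1) V \<iota> N))"

end

theory Submission
  imports Defs
begin

text \<open>If \<open>A \<subset> B\<close> are submodules of \<open>M\<close> and \<open>v \<in> B - A\<close>, choose by Zorn's lemma a submodule \<open>N\<close> with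
  \<open>A \<subseteq> N \<subseteq> B\<close> maximal among those not containing \<open>v\<close>, and let \<open>U\<close> be generated by \<open>N\<close> and \<open>v\<close>.  Then
  \<open>U / N\<close> is a simple object of the category, hence some \<open>L(\<lambda>_i)\<close>; its highest weight vector lifts to
  \<open>M_(\<lambda>_i)\<close>, so that \<open>A \<inter> M_(\<lambda>_i)\<close> is strictly smaller than \<open>B \<inter> M_(\<lambda>_i)\<close>.  Hence
  \<open>\<Sum>i. dim (C \<inter> M_(\<lambda>_i))\<close> increases strictly along every chain of submodules \<open>C\<close>.

  That generalized weight spaces are compatible with subquotients rests on the commutation of the
  operators of the Cartan subalgebra, including \<open>d = - L_0\<close>.  For the latter no Sugawara calculation is
  needed: the zero mode of \<open>H \<in> \<hh>\<close> is a derivation of all products that annihilates the Sugawara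
  vector, because it acts with opposite weights on the two factors of each summand.\<close>

section \<open>Commuting families of operators\<close>

text \<open>Everything is relative to \<open>E\<close>, since the operators of a module are only
  controlled on its carrier. The index set will be all triples \<open>(H, a, b)\<close>, standing
  for H + aK + bd.\<close>

locale commuting_ops =
  fixes E :: "'m::complex_vector set" and I :: "'i set" and T :: "'i \<Rightarrow> 'm \<Rightarrow> 'm"
  assumes subspace: "cvs.subspace E"
    and closed: "i \<in> I \<Longrightarrow> v \<in> E \<Longrightarrow> T i v \<in> E"
    and linear: "i \<in> I \<Longrightarrow> linear_on E (T i)"
    and commute: "i \<in> I \<Longrightarrow> j \<in> I \<Longrightarrow> v \<in> E \<Longrightarrow> T i (T j v) = T j (T i v)"
begin

definition shift :: "'i \<Rightarrow> complex \<Rightarrow> 'm \<Rightarrow> 'm" where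
  "shift i c = (\<lambda>v. T i v - c *\<^sub>C v)"

text \<open>The exponent may depend on \<open>i\<close>, in agreement with
  \<open>gen_weight_space\<close>.\<close>

definition joint_gen_eigenspace :: "('i \<Rightarrow> complex) \<Rightarrow> 'm set" where
  "joint_gen_eigenspace \<chi> = {v \<in> E. \<forall>i\<in>I. \<exists>n. (shift i (\<chi> i) ^^ n) v = 0}"

lemma T_add: "i \<in> I \<Longrightarrow> u \<in> E \<Longrightarrow> v \<in> E \<Longrightarrow> T i (u + v) = T i u + T i v"
  and T_scale: "i \<in> I \<Longrightarrow> v \<in> E \<Longrightarrow> T i (c *\<^sub>C v) = c *\<^sub>C T i v"
  using linear by (auto simp: linear_on_def)

lemma T_diff: "i \<in> I \<Longrightarrow> u \<in> E \<Longrightarrow> v \<in> E \<Longrightarrow> T i (u - v) = T i u - T i v"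
  using T_add[of i "u - v" v] cvs.subspace_diff[OF subspace, of u v] by (simp add: algebra_simps)

lemma T_zero: "i \<in> I \<Longrightarrow> T i 0 = 0"
  using T_diff[of i 0 0] cvs.subspace_0[OF subspace] by simp

lemma shift_closed: "i \<in> I \<Longrightarrow> v \<in> E \<Longrightarrow> shift i c v \<in> E"
  by (simp add: shift_def closed cvs.subspace_diff[OF subspace] cvs.subspace_scale[OF subspace])

lemma shift_pow_closed: "i \<in> I \<Longrightarrow> v \<in> E \<Longrightarrow> (shift i c ^^ n) v \<in> E"
  by (induction n) (auto simp: shift_closed)

lemma shift_zero: "i \<in> I \<Longrightarrow> shift i c 0 = 0"
  by (simp add: shift_def T_zero)

lemma shift_pow_zero: "i \<in> I \<Longrightarrow> (shift i c ^^ n) 0 = 0"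
  by (induction n) (auto simp: shift_zero)

lemma shift_add: "i \<in> I \<Longrightarrow> u \<in> E \<Longrightarrow> v \<in> E \<Longrightarrow> shift i c (u + v) = shift i c u + shift i c v"
  by (simp add: shift_def T_add scaleC_add_right)

lemma shift_pow_add:
  "i \<in> I \<Longrightarrow> u \<in> E \<Longrightarrow> v \<in> E \<Longrightarrow> (shift i c ^^ n) (u + v) = (shift i c ^^ n) u + (shift i c ^^ n) v"
  by (induction n) (auto simp: shift_add shift_pow_closed)

lemma shift_scale: "i \<in> I \<Longrightarrow> v \<in> E \<Longrightarrow> shift i c (a *\<^sub>C v) = a *\<^sub>C shift i c v"
  by (simp add: shift_def T_scale cvs.scale_right_diff_distrib scaleC_scaleC mult.commute)

lemma shift_pow_scale: "i \<in> I \<Longrightarrow> v \<in> E \<Longrightarrow> (shift i c ^^ n) (a *\<^sub>C v) = a *\<^sub>C (shift i c ^^ n) v"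
  by (induction n) (auto simp: shift_scale shift_pow_closed)

lemma shift_pow_sum:
  assumes "i \<in> I" "finite F" "\<And>x. x \<in> F \<Longrightarrow> g x \<in> E"
  shows "(shift i c ^^ n) (\<Sum>x\<in>F. g x) = (\<Sum>x\<in>F. (shift i c ^^ n) (g x))"
  using assms(2,3)
  by (induction F rule: finite_induct)
    (auto simp: assms(1) shift_pow_zero shift_pow_add cvs.subspace_sum[OF subspace])

lemma shift_commute:
  "i \<in> I \<Longrightarrow> j \<in> I \<Longrightarrow> v \<in> E \<Longrightarrow> shift i c (shift j d v) = shift j d (shift i c v)"
  by (simp add: shift_def T_diff T_scale closed cvs.subspace_scale[OF subspace] commute
      cvs.scale_right_diff_distrib scaleC_scaleC mult.commute algebra_simps)

lemma shift_commute_pow: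
  "i \<in> I \<Longrightarrow> j \<in> I \<Longrightarrow> v \<in> E \<Longrightarrow> shift i c ((shift j d ^^ n) v) = (shift j d ^^ n) (shift i c v)"
  by (induction n) (simp_all add: shift_commute[of i j _ c d] shift_pow_closed)

lemma shift_pow_commute:
  "i \<in> I \<Longrightarrow> j \<in> I \<Longrightarrow> v \<in> E \<Longrightarrow>
    (shift i c ^^ m) ((shift j d ^^ n) v) = (shift j d ^^ n) ((shift i c ^^ m) v)"
  by (induction m) (simp_all add: shift_commute_pow[of i j _ c] shift_pow_closed)

lemma shift_pow_mono:
  assumes "i \<in> I" "(shift i c ^^ m) v = 0" "m \<le> n"
  shows "(shift i c ^^ n) v = 0"
proof -
  have "(shift i c ^^ (n - m + m)) v = 0"
    unfolding funpow_add using assms by (simp add: shift_pow_zero)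
  then show ?thesis using assms(3) by simp
qed

text \<open>Powers of the shifts commute. The number \<open>d\<close> is arbitrary, so a shift that
  kills one component keeps all others in their own eigenspaces.\<close>

lemma joint_gen_eigenspace_shift:
  assumes "v \<in> joint_gen_eigenspace \<chi>" "j \<in> I"
  shows "(shift j d ^^ n) v \<in> joint_gen_eigenspace \<chi>"
  unfolding joint_gen_eigenspace_def
proof (intro CollectI conjI ballI)
  show "(shift j d ^^ n) v \<in> E"
    using assms by (auto simp: joint_gen_eigenspace_def shift_pow_closed)
  fix i assume i: "i \<in> I"
  then obtain m where "(shift i (\<chi> i) ^^ m) v = 0"
    using assms by (auto simp: joint_gen_eigenspace_def)
  moreover have "v \<in> E" using assms by (auto simp: joint_gen_eigenspace_def)
  ultimately show "\<exists>m. (shift i (\<chi> i) ^^ m) ((shift j d ^^ n) v) = 0"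
    using i assms(2) shift_pow_commute[of i j v m "\<chi> i" n d]
    by (intro exI[of _ m]) (simp add: shift_pow_zero)
qed

lemma joint_gen_eigenspace_subspace: "cvs.subspace (joint_gen_eigenspace \<chi>)"
  unfolding cvs.subspace_def
proof (intro conjI ballI allI)
  show "0 \<in> joint_gen_eigenspace \<chi>"
    by (auto simp: joint_gen_eigenspace_def cvs.subspace_0[OF subspace] shift_pow_zero)
next
  fix u v assume u: "u \<in> joint_gen_eigenspace \<chi>" and v: "v \<in> joint_gen_eigenspace \<chi>"
  have "\<exists>k. (shift i (\<chi> i) ^^ k) (u + v) = 0" if i: "i \<in> I" for i
  proof -
    obtain m where "(shift i (\<chi> i) ^^ m) u = 0"
      using i u by (auto simp: joint_gen_eigenspace_def)
    moreover obtain n where "(shift i (\<chi> i) ^^ n) v = 0"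
      using i v by (auto simp: joint_gen_eigenspace_def)
    ultimately have "(shift i (\<chi> i) ^^ max m n) u = 0" "(shift i (\<chi> i) ^^ max m n) v = 0"
      using shift_pow_mono[OF i] by (meson max.cobounded1, meson max.cobounded2)
    then show ?thesis
      using i u v by (intro exI[of _ "max m n"]) (auto simp: joint_gen_eigenspace_def shift_pow_add)
  qed
  then show "u + v \<in> joint_gen_eigenspace \<chi>"
    using u v by (auto simp: joint_gen_eigenspace_def cvs.subspace_add[OF subspace])
next
  fix a v assume v: "v \<in> joint_gen_eigenspace \<chi>"
  then show "a *\<^sub>C v \<in> joint_gen_eigenspace \<chi>"
    by (fastforce simp: joint_gen_eigenspace_def cvs.subspace_scale[OF subspace] shift_pow_scale)
qed

text \<open>Induction on \<open>m\<close>: the vector \<open>shift i c v\<close> meets the same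
  conditions with a smaller exponent, so it vanishes and \<open>v\<close> is a true eigenvector.
  Then \<open>shift i d\<close> multiplies \<open>v\<close> by the nonzero scalar
  \<open>c - d\<close>, yet some power of it kills \<open>v\<close>.\<close>

lemma gen_eigenspaces_disjoint:
  assumes i: "i \<in> I" and "c \<noteq> d" and "v \<in> E"
    and "(shift i c ^^ m) v = 0" and "(shift i d ^^ n) v = 0"
  shows "v = 0"
  using assms(3-5)
proof (induction m arbitrary: v)
  case (Suc m)
  have "shift i c v = 0"
  proof (rule Suc.IH)
    show "shift i c v \<in> E" using i Suc.prems by (simp add: shift_closed)
    show "(shift i c ^^ m) (shift i c v) = 0" using Suc.prems(2) by (simp add: funpow_swap1)
    show "(shift i d ^^ n) (shift i c v) = 0"
      using Suc.prems i shift_commute_pow[of i i v c n d] by (simp add: shift_zero)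
  qed
  then have "T i v = c *\<^sub>C v" by (simp add: shift_def)
  then have "shift i d v = (c - d) *\<^sub>C v" by (simp add: shift_def cvs.scale_left_diff_distrib)
  then have "(shift i d ^^ k) v = (c - d) ^ k *\<^sub>C v" for k
    by (induction k)
      (use i Suc.prems in \<open>auto simp: scaleC_one shift_scale scaleC_scaleC mult.commute\<close>)
  with Suc.prems(3) show ?case using \<open>c \<noteq> d\<close> by simp
qed simp

text \<open>For each \<mu> in \<open>F\<close> an operator separating \<mu> from the new index \<nu>
  is used: a power of its \<nu>-shift removes \<open>x \<nu>\<close> from the relation. What remains
  shows that \<open>x \<mu>\<close> is a generalized eigenvector of this operator for two different
  eigenvalues.\<close>

lemma joint_gen_eigenspaces_independent:
  assumes "finite F"
    and "\<And>\<mu>. \<mu> \<in> F \<Longrightarrow> x \<mu> \<in> joint_gen_eigenspace (\<chi> \<mu>)"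
    and "\<And>\<mu> \<nu>. \<mu> \<in> F \<Longrightarrow> \<nu> \<in> F \<Longrightarrow> \<mu> \<noteq> \<nu> \<Longrightarrow> \<exists>i\<in>I. \<chi> \<mu> i \<noteq> \<chi> \<nu> i"
    and "(\<Sum>\<mu>\<in>F. x \<mu>) = 0"
  shows "\<forall>\<mu>\<in>F. x \<mu> = 0"
  using assms
proof (induction F arbitrary: x rule: finite_induct)
  case (insert \<nu> F)
  have E: "x \<mu> \<in> E" if "\<mu> \<in> insert \<nu> F" for \<mu>
    using insert.prems(1)[OF that] by (simp add: joint_gen_eigenspace_def)
  have F: "x \<mu> = 0" if \<mu>: "\<mu> \<in> F" for \<mu>
  proof -
    have "\<mu> \<noteq> \<nu>" using \<mu> insert.hyps by auto
    then obtain i where i: "i \<in> I" and ne: "\<chi> \<mu> i \<noteq> \<chi> \<nu> i" using insert.prems(2)[of \<mu> \<nu>] \<mu> by auto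
    obtain n where n: "(shift i (\<chi> \<nu> i) ^^ n) (x \<nu>) = 0"
      using insert.prems(1)[of \<nu>] i by (auto simp: joint_gen_eigenspace_def)
    let ?S = "shift i (\<chi> \<nu> i) ^^ n"
    have "0 = ?S (\<Sum>\<kappa>\<in>insert \<nu> F. x \<kappa>)" using i by (simp only: insert.prems(3) shift_pow_zero)
    also have "\<dots> = (\<Sum>\<kappa>\<in>insert \<nu> F. ?S (x \<kappa>))"
      by (rule shift_pow_sum) (use i insert.hyps E in auto)
    also have "\<dots> = (\<Sum>\<kappa>\<in>F. ?S (x \<kappa>))" using insert.hyps n by simp
    finally have "(\<Sum>\<kappa>\<in>F. ?S (x \<kappa>)) = 0" by simp
    \<comment> \<open>The induction hypothesis is applied to the shifted family, not to
      \<open>x\<close> itself.\<close>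
    then have "\<forall>\<kappa>\<in>F. ?S (x \<kappa>) = 0"
      using insert.prems(1,2) i by (intro insert.IH) (auto intro: joint_gen_eigenspace_shift)
    moreover obtain m where "(shift i (\<chi> \<mu> i) ^^ m) (x \<mu>) = 0"
      using insert.prems(1)[of \<mu>] i \<mu> by (auto simp: joint_gen_eigenspace_def)
    ultimately show ?thesis using gen_eigenspaces_disjoint[OF i ne] E \<mu> by blast
  qed
  then have "x \<nu> = 0" using insert.prems(3) insert.hyps by simp
  with F show ?case by simp
qed simp

end


section \<open>Subspaces of complex vector spaces\<close>

text \<open>A basis of \<open>N\<close> is extended to one of the whole space; \<open>p\<close>
  kills the former and fixes the added vectors. Its image is a complement of \<open>N\<close>, which
  serves as a model of the quotient inside the same type.\<close>

lemma projection_along_subspace: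
  fixes N :: "'m::complex_vector set"
  assumes N: "cvs.subspace N"
  obtains p :: "'m \<Rightarrow> 'm"
  where "linear_on UNIV p" "\<And>u. u \<in> N \<Longrightarrow> p u = 0" "\<And>u. u - p u \<in> N"
proof -
  interpret pair: vector_space_pair "scaleC :: complex \<Rightarrow> 'm \<Rightarrow> 'm" "scaleC :: complex \<Rightarrow> 'm \<Rightarrow> 'm" ..
  obtain B where B: "B \<subseteq> N" "cvs.independent B" "N \<subseteq> cvs.span B"
    "card B = cvs.dim N"
    by (rule cvs.basis_exists)
  define B' where "B' = cvs.extend_basis B"
  have B': "cvs.independent B'" "B \<subseteq> B'" "cvs.span B' = UNIV"
    using B(2) by (auto simp: B'_def cvs.independent_extend_basis cvs.extend_basis_superset)
  obtain p where p: "Vector_Spaces.linear scaleC scaleC p"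
    and pB: "\<forall>b\<in>B'. p b = (if b \<in> B then 0 else b)"
    using pair.linear_independent_extend[OF B'(1), of "\<lambda>b. if b \<in> B then 0 else b"]
    by (elim exE conjE) (rule that)
  have add: "p (u + v) = p u + p v" and scale: "p (c *\<^sub>C u) = c *\<^sub>C p u" for u v c
    using p by (auto simp: Vector_Spaces.linear_iff)
  have zero: "p 0 = 0" using scale[of 0 0] by simp
  have "cvs.subspace {u. p u = 0}"
    by (auto simp: cvs.subspace_def add scale zero)
  then have "cvs.span B \<subseteq> {u. p u = 0}"
    using pB B'(2) by (intro cvs.span_minimal) auto
  moreover have "cvs.subspace {u. u - p u \<in> N}"
    using cvs.subspace_add[OF N] cvs.subspace_scale[OF N] cvs.subspace_0[OF N]
    by (auto simp: cvs.subspace_def add scale zero add_diff_add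
        simp flip: cvs.scale_right_diff_distrib)
  then have "cvs.span B' \<subseteq> {u. u - p u \<in> N}"
    using pB B(1) cvs.subspace_0[OF N] by (intro cvs.span_minimal) auto
  ultimately have "\<And>u. u \<in> N \<Longrightarrow> p u = 0" "\<And>u. u - p u \<in> N"
    using B(3) B'(3) by auto
  moreover have "linear_on UNIV p" using add scale by (simp add: linear_on_def)
  ultimately show ?thesis using that[of p] by simp
qed

text \<open>\<open>cvs.dim\<close> is 0 in infinite dimension, so a finite basis must be secured
  before dimensions can be compared.\<close>

lemma finite_dim_subspace:
  assumes "finite B" "S \<subseteq> cvs.span B"
  obtains C where "C \<subseteq> S" "finite C" "cvs.independent C" "S \<subseteq> cvs.span C" "card C = cvs.dim S"
proof -
  obtain C where C: "C \<subseteq> S" "cvs.independent C" "S \<subseteq> cvs.span C" "card C = cvs.dim S"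
    by (rule cvs.basis_exists)
  have "C \<subseteq> cvs.span B" using C(1) assms(2) by (rule subset_trans)
  then have "finite C" using cvs.independent_span_bound[OF assms(1) C(2)] by simp
  with C that show ?thesis by blast
qed

text \<open>For strictness, a vector of \<open>S'\<close> outside the subspace \<open>S\<close>
  extends a basis of \<open>S\<close> to a larger independent set in the span of a basis of
  \<open>S'\<close>.\<close>

lemma dim_mono_strict:
  assumes fin: "finite B" "S' \<subseteq> cvs.span B" and sub: "S \<subseteq> S'"
  shows "cvs.dim S \<le> cvs.dim S'"
    and "cvs.subspace S \<Longrightarrow> S \<noteq> S' \<Longrightarrow> cvs.dim S < cvs.dim S'"
proof -
  obtain C' where C': "C' \<subseteq> S'" "finite C'" "cvs.independent C'" "S' \<subseteq> cvs.span C'" "card C' = cvs.dim S'"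
    by (rule finite_dim_subspace[OF fin])
  obtain C where C: "C \<subseteq> S" "finite C" "cvs.independent C" "S \<subseteq> cvs.span C" "card C = cvs.dim S"
    by (rule finite_dim_subspace[OF C'(2) subset_trans[OF sub C'(4)]])
  have "card C \<le> card C'"
    using cvs.independent_span_bound[OF C'(2) C(3)] C(1) C'(4) sub by blast
  then show "cvs.dim S \<le> cvs.dim S'" using C(5) C'(5) by simp
  assume S: "cvs.subspace S" "S \<noteq> S'"
  then obtain x where x: "x \<in> S'" "x \<notin> S" using sub by auto
  have "x \<notin> cvs.span C" using x(2) S(1) C(1) cvs.span_minimal by blast
  then have "cvs.independent (insert x C)" "x \<notin> C"
    using C(3) cvs.independent_insertI cvs.span_base by blast+
  moreover have "insert x C \<subseteq> cvs.span C'" using x C(1) sub C'(4) by blast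
  ultimately have "card (insert x C) \<le> card C'"
    using cvs.independent_span_bound[OF C'(2)] by blast
  then show "cvs.dim S < cvs.dim S'" using \<open>x \<notin> C\<close> C(2,5) C'(5) by simp
qed


section \<open>The Cartan subalgebra\<close>

lemma opp_index_less: "p < 2*l \<Longrightarrow> opp_index l p < 2*l"
  and opp_index_opp: "p < 2*l \<Longrightarrow> opp_index l (opp_index l p) = p"
  by (auto simp: opp_index_def)

lemma Jmat_opp: "p < 2*l \<Longrightarrow> q < 2*l \<Longrightarrow> Jmat l $$ (p, q) = (if q = opp_index l p then 1 else 0)"
  by (auto simp: Jmat_def opp_index_def)

text \<open>Each row and column of \<open>Jmat l\<close> has a single 1, at the paired index, so
  multiplication by it only permutes entries.\<close>

lemma so_alg_iff:
  "A \<in> so_alg l \<longleftrightarrow> A \<in> carrier_mat (2*l) (2*l) \<and>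
     (\<forall>p<2*l. \<forall>r<2*l. A $$ (opp_index l p, r) + A $$ (opp_index l r, p) = 0)"
proof (cases "A \<in> carrier_mat (2*l) (2*l)")
  case True
  have J: "Jmat l \<in> carrier_mat (2*l) (2*l)" by (simp add: Jmat_def)
  have *: "(transpose_mat A * Jmat l + Jmat l * A) $$ (p, r)
      = A $$ (opp_index l p, r) + A $$ (opp_index l r, p)" if pr: "p < 2*l" "r < 2*l" for p r
  proof -
    have "(Jmat l * A) $$ (p, r) = (\<Sum>q = 0..<2*l. Jmat l $$ (p, q) * A $$ (q, r))"
      using True J pr by (simp add: scalar_prod_def)
    also have "\<dots> = (\<Sum>q = 0..<2*l. if q = opp_index l p then A $$ (q, r) else 0)"
      by (rule sum.cong) (use pr in \<open>auto simp: Jmat_opp\<close>)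
    also have "\<dots> = A $$ (opp_index l p, r)" using opp_index_less[OF pr(1)] by simp
    finally have 1: "(Jmat l * A) $$ (p, r) = A $$ (opp_index l p, r)" .
    have J': "Jmat l $$ (q, r) = (if q = opp_index l r then 1 else 0)" if "q < 2*l" for q
      using that pr by (auto simp: Jmat_def opp_index_def)
    have "(transpose_mat A * Jmat l) $$ (p, r) = (\<Sum>q = 0..<2*l. A $$ (q, p) * Jmat l $$ (q, r))"
      using True J pr by (simp add: scalar_prod_def)
    also have "\<dots> = (\<Sum>q = 0..<2*l. if q = opp_index l r then A $$ (q, p) else 0)"
      by (rule sum.cong) (use pr in \<open>auto simp: J'\<close>)
    also have "\<dots> = A $$ (opp_index l r, p)" using opp_index_less[OF pr(2)] by simp
    finally show ?thesis using 1 True J pr by simp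
  qed
  have "transpose_mat A * Jmat l + Jmat l * A = 0\<^sub>m (2*l) (2*l) \<longleftrightarrow>
     (\<forall>p<2*l. \<forall>r<2*l. (transpose_mat A * Jmat l + Jmat l * A) $$ (p, r) = 0)"
    using True J by (auto simp: mat_eq_iff)
  with True * show ?thesis by (simp add: so_alg_def)
qed (simp add: so_alg_def)

text \<open>Passing from the entry \<open>(opp_index l p, r)\<close> to
  \<open>(opp_index l r, p)\<close> exchanges the two terms of \<open>so_gen\<close>, which have
  opposite signs.\<close>

lemma so_gen_in_so_alg:
  assumes "i < 2*l" "j < 2*l"
  shows "so_gen l i j \<in> so_alg l"
  unfolding so_alg_iff
proof (intro conjI allI impI)
  fix p r assume pr: "p < 2*l" "r < 2*l"
  have eqs: "opp_index l p = i \<longleftrightarrow> p = opp_index l i" "opp_index l p = opp_index l j \<longleftrightarrow> p = j"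
    "opp_index l r = i \<longleftrightarrow> r = opp_index l i" "opp_index l r = opp_index l j \<longleftrightarrow> r = j"
    using pr assms opp_index_opp by metis+
  show "so_gen l i j $$ (opp_index l p, r) + so_gen l i j $$ (opp_index l r, p) = 0"
    using pr by (simp add: so_gen_def opp_index_less eqs conj_commute)
qed (simp add: so_gen_def)

lemma cartan_opp:
  assumes H: "H \<in> cartan l" and "p < 2*l"
  shows "H $$ (opp_index l p, opp_index l p) = - H $$ (p, p)"
  using assms opp_index_less[OF assms(2)] opp_index_opp[OF assms(2)]
  by (fastforce simp: cartan_def so_alg_iff add_eq_0_iff)

lemma cartan_carrier: "H \<in> cartan l \<Longrightarrow> H \<in> carrier_mat (2*l) (2*l)"
  by (simp add: cartan_def so_alg_def)

lemma lie_cartan_index: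
  assumes H: "H \<in> cartan l" and A: "A \<in> carrier_mat (2*l) (2*l)" and pr: "p < 2*l" "r < 2*l"
  shows "lie H A $$ (p, r) = (H $$ (p, p) - H $$ (r, r)) * A $$ (p, r)"
proof -
  have d: "H $$ (a, b) = 0" if "a < 2*l" "b < 2*l" "a \<noteq> b" for a b
    using H cartan_carrier[OF H] that by (auto simp: cartan_def diagonal_mat_def)
  have "(H * A) $$ (p, r) = (\<Sum>q = 0..<2*l. H $$ (p, q) * A $$ (q, r))"
    using cartan_carrier[OF H] A pr by (simp add: scalar_prod_def)
  also have "\<dots> = (\<Sum>q = 0..<2*l. if q = p then H $$ (p, p) * A $$ (p, r) else 0)"
    by (rule sum.cong) (use pr d in auto)
  finally have 1: "(H * A) $$ (p, r) = H $$ (p, p) * A $$ (p, r)" using pr by simp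
  have "(A * H) $$ (p, r) = (\<Sum>q = 0..<2*l. A $$ (p, q) * H $$ (q, r))"
    using cartan_carrier[OF H] A pr by (simp add: scalar_prod_def)
  also have "\<dots> = (\<Sum>q = 0..<2*l. if q = r then A $$ (p, r) * H $$ (r, r) else 0)"
    by (rule sum.cong) (use pr d in auto)
  finally have 2: "(A * H) $$ (p, r) = A $$ (p, r) * H $$ (r, r)" using pr by simp
  show ?thesis
    using 1 2 cartan_carrier[OF H] A pr by (simp add: lie_def algebra_simps)
qed

text \<open>The zero matrix is written as a multiple of \<open>H'\<close> so that homogeneity of
  \<iota> sends it to 0.\<close>

lemma lie_cartan_cartan:
  assumes H: "H \<in> cartan l" and H': "H' \<in> cartan l"
  shows "lie H H' = 0 \<cdot>\<^sub>m H'"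
proof (rule eq_matI)
  note c = cartan_carrier[OF H] cartan_carrier[OF H']
  fix i j assume "i < dim_row (0 \<cdot>\<^sub>m H')" "j < dim_col (0 \<cdot>\<^sub>m H')"
  then show "lie H H' $$ (i, j) = (0 \<cdot>\<^sub>m H') $$ (i, j)"
    using lie_cartan_index[OF H c(2), of i j] c H'
    by (cases "i = j") (auto simp: cartan_def diagonal_mat_def)
qed (use cartan_carrier[OF H] cartan_carrier[OF H'] in \<open>auto simp: lie_def\<close>)

text \<open>The unit entries of \<open>so_gen l i j\<close> sit at (i, j) and at the pair (j', i')
  of opposite indices. Both have the same weight because \<open>H\<close> changes sign under passing
  to the opposite index.\<close>

lemma lie_cartan_so_gen:
  assumes H: "H \<in> cartan l" and ij: "i < 2*l" "j < 2*l"
  shows "lie H (so_gen l i j) = (H $$ (i, i) - H $$ (j, j)) \<cdot>\<^sub>m so_gen l i j"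
proof (rule eq_matI)
  have g: "so_gen l i j \<in> carrier_mat (2*l) (2*l)" by (simp add: so_gen_def)
  fix p r assume "p < dim_row ((H $$ (i, i) - H $$ (j, j)) \<cdot>\<^sub>m so_gen l i j)"
    "r < dim_col ((H $$ (i, i) - H $$ (j, j)) \<cdot>\<^sub>m so_gen l i j)"
  then have pr: "p < 2*l" "r < 2*l" by (auto simp: so_gen_def)
  have "H $$ (p, p) - H $$ (r, r) = H $$ (i, i) - H $$ (j, j)" if "so_gen l i j $$ (p, r) \<noteq> 0"
  proof -
    have "p = i \<and> r = j \<or> p = opp_index l j \<and> r = opp_index l i"
      using that pr by (simp add: so_gen_def split: if_splits)
    then show ?thesis using cartan_opp[OF H ij(1)] cartan_opp[OF H ij(2)] by auto
  qed
  then show "lie H (so_gen l i j) $$ (p, r) = ((H $$ (i, i) - H $$ (j, j)) \<cdot>\<^sub>m so_gen l i j) $$ (p, r)"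
    using pr g lie_cartan_index[OF H g pr] by auto
qed (use cartan_carrier[OF H] in \<open>auto simp: lie_def so_gen_def\<close>)

section \<open>Separation of weights by the Cartan subalgebra\<close>

lemma so_gen_diag_in_cartan:
  assumes "i < l"
  shows "so_gen l i i \<in> cartan l"
  using so_gen_in_so_alg[of i l i] assms
  by (auto simp: cartan_def diagonal_mat_def so_gen_def)

lemma sum_cartan_so_gen:
  assumes "i < l"
  shows "(\<Sum>j<l. f j * so_gen l i i $$ (j, j)) = f i"
proof -
  have "(\<Sum>j<l. f j * so_gen l i i $$ (j, j)) = (\<Sum>j<l. if j = i then f i else 0)"
    by (rule sum.cong) (use assms in \<open>auto simp: so_gen_def opp_index_def\<close>)
  then show ?thesis using assms by simp
qed

text \<open>The matrices \<open>so_gen l i i\<close> read off the finite coordinates, K and d the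
  remaining two; membership in \<open>hdual l\<close> fixes the coordinates of index at least
  \<open>l\<close>.\<close>

lemma weval_separates:
  assumes "\<mu> \<in> hdual l" "\<nu> \<in> hdual l" "\<mu> \<noteq> \<nu>"
  shows "\<exists>H\<in>cartan l. \<exists>a b. weval l \<mu> H a b \<noteq> weval l \<nu> H a b"
proof (rule ccontr)
  assume "\<not> ?thesis"
  then have eq: "weval l \<mu> H a b = weval l \<nu> H a b" if "H \<in> cartan l" for H a b
    using that by auto
  obtain f c e f' c' e' where \<mu>\<nu>: "\<mu> = (f, c, e)" "\<nu> = (f', c', e')"
    by (metis prod_cases3)
  have fi: "f i = f' i" if "i < l" for i
    using eq[OF so_gen_diag_in_cartan[OF that], of 0 0] that by (simp add: \<mu>\<nu> weval_def sum_cartan_so_gen)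
  then have "f = f'"
    using assms(1,2) by (auto simp: \<mu>\<nu> hdual_def fun_eq_iff) (metis not_less)
  \<comment> \<open>With \<open>H = 0\<close>, the choices (1, 0) and (0, 1) of (a, b) isolate the
    values on K and on d.\<close>
  have z: "0\<^sub>m (2*l) (2*l) \<in> cartan l"
    by (auto simp: cartan_def so_alg_iff diagonal_mat_def opp_index_less)
  have "c = c'" "e = e'"
    using eq[OF z, of 1 0] eq[OF z, of 0 1] \<open>f = f'\<close> by (auto simp: \<mu>\<nu> weval_def)
  with \<open>f = f'\<close> show False using assms(3) \<mu>\<nu> by simp
qed

text \<open>\<open>weval\<close> ignores the components of index at least \<open>l\<close>, so every weight may be moved into \<open>hdual l\<close>.\<close>

definition truncate_weight :: "nat \<Rightarrow> aweight \<Rightarrow> aweight" where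
  "truncate_weight l \<nu> = (\<lambda>i. if i < l then fst \<nu> i else 0, snd \<nu>)"

lemma truncate_weight_in_hdual: "truncate_weight l \<nu> \<in> hdual l"
  by (cases \<nu>) (auto simp: truncate_weight_def hdual_def)

lemma weval_truncate_weight: "weval l (truncate_weight l \<nu>) = weval l \<nu>"
  by (cases \<nu>) (auto simp: truncate_weight_def weval_def fun_eq_iff)

lemma gen_weight_space_truncate_weight:
  "gen_weight_space l M (truncate_weight l \<nu>) = gen_weight_space l M \<nu>"
  by (simp add: gen_weight_space_def weval_truncate_weight)



section \<open>Modules over an affine vertex algebra\<close>

lemma vertex_moduleD:
  assumes "vertex_module V M"
  shows vertex_module_subspace: "cvs.subspace (vcar M)"
    and mprod_closed: "v \<in> vcar M \<Longrightarrow> mprod M a n v \<in> vcar M"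
    and mprod_add: "u \<in> vcar M \<Longrightarrow> v \<in> vcar M \<Longrightarrow> mprod M a n (u + v) = mprod M a n u + mprod M a n v"
    and mprod_scale: "v \<in> vcar M \<Longrightarrow> mprod M a n (c *\<^sub>C v) = c *\<^sub>C mprod M a n v"
    and mprod_add_left: "v \<in> vcar M \<Longrightarrow> mprod M (a + b) n v = mprod M a n v + mprod M b n v"
    and mprod_scale_left: "v \<in> vcar M \<Longrightarrow> mprod M (c *\<^sub>C a) n v = c *\<^sub>C mprod M a n v"
    and mprod_truncated: "v \<in> vcar M \<Longrightarrow> \<exists>N. \<forall>n\<ge>N. mprod M a n v = 0"
    and mprod_vac: "v \<in> vcar M \<Longrightarrow> mprod M (vac V) n v = (if n = -1 then v else 0)"
    and mprod_borcherds: "v \<in> vcar M \<Longrightarrow> borcherds_at V (mprod M) v"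
  using assms by (auto simp: vertex_module_def linear_on_def image_subset_iff)

lemma mprod_zero_left: "vertex_module V M \<Longrightarrow> v \<in> vcar M \<Longrightarrow> mprod M 0 n v = 0"
  using mprod_scale_left[of V M v 0 0 n] by simp

lemma mprod_zero: "vertex_module V M \<Longrightarrow> mprod M a n 0 = 0"
  using mprod_scale[of V M 0 a n 0] cvs.subspace_0[OF vertex_module_subspace[of V M]] by simp

lemma mprod_minus: "vertex_module V M \<Longrightarrow> v \<in> vcar M \<Longrightarrow> mprod M a n (- v) = - mprod M a n v"
  using mprod_scale[of V M v a n "-1"] by (simp add: scaleC_one)

lemma mprod_diff:
  "vertex_module V M \<Longrightarrow> u \<in> vcar M \<Longrightarrow> v \<in> vcar M \<Longrightarrow> mprod M a n (u - v) = mprod M a n u - mprod M a n v"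
  using mprod_add[of V M u "- v" a n] cvs.subspace_neg[OF vertex_module_subspace[of V M], of v]
  by (simp add: mprod_minus)

lemma mprod_sum:
  assumes "vertex_module V M" "\<And>x. x \<in> F \<Longrightarrow> g x \<in> vcar M"
  shows "mprod M a n (\<Sum>x\<in>F. g x) = (\<Sum>x\<in>F. mprod M a n (g x))"
proof (cases "finite F")
  case True
  then show ?thesis using assms(2)
    by (induction F rule: finite_induct)
      (auto simp: mprod_zero[OF assms(1)] mprod_add[OF assms(1)]
        cvs.subspace_sum[OF vertex_module_subspace[OF assms(1)]])
qed (simp add: mprod_zero[OF assms(1)])

text \<open>The case \<open>m = n = 0\<close> of the Borcherds identity.\<close>

lemma zero_mode_commutator:
  assumes M: "vertex_module V M" and c: "c \<in> vcar M"
  shows "mprod M a 0 (mprod M b k c) - mprod M b k (mprod M a 0 c) = mprod M (nprod V a 0 b) k c"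
proof -
  \<comment> \<open>This coefficient cuts both sums of the identity down to their term j =
    0.\<close>
  have z: "(0 :: complex) gchoose j = (if j = 0 then 1 else 0)" for j
    by (cases j) auto
  have single: "Sum_any g = g 0" if "\<And>j. j > 0 \<Longrightarrow> g j = 0" for g :: "nat \<Rightarrow> 'b"
  proof -
    have "{j. g j \<noteq> 0} \<subseteq> {0}" using that by auto
    then show ?thesis using Sum_any.expand_superset[of "{0}" g] by simp
  qed
  have "Sum_any (\<lambda>j::nat. (of_int 0 gchoose j) *\<^sub>C
        mprod M (nprod V a (0 + int j) b) (0 + k - int j) c) =
     Sum_any (\<lambda>j::nat. ((-1) ^ j * (of_int 0 gchoose j)) *\<^sub>C
        (mprod M a (0 + 0 - int j) (mprod M b (k + int j) c)
         - ((-1) powi 0) *\<^sub>C mprod M b (0 + k - int j) (mprod M a (0 + int j) c)))"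
    using mprod_borcherds[OF M c] unfolding borcherds_at_def by blast
  then show ?thesis
    by (subst (asm) single; (subst (asm) single)?) (simp_all add: z scaleC_one)
qed

section \<open>Submodules of vertex algebra modules\<close>

lemma vsubmoduleD:
  assumes "vsubmodule V M U"
  shows vsubmodule_subspace: "cvs.subspace U"
    and vsubmodule_subset: "U \<subseteq> vcar M"
    and vsubmodule_mprod: "u \<in> U \<Longrightarrow> mprod M a n u \<in> U"
  using assms by (auto simp: vsubmodule_def image_subset_iff)

lemma vsubmodule_full: "vertex_module V M \<Longrightarrow> vsubmodule V M (vcar M)"
  by (auto simp: vsubmodule_def vertex_module_def)

lemma vsubmodule_zero: "vertex_module V M \<Longrightarrow> vsubmodule V M {0}"
  using cvs.subspace_0[OF vertex_module_subspace[of V M]]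
  by (auto simp: vsubmodule_def mprod_zero)

lemma vsubmodule_Inter:
  assumes "\<And>W. W \<in> \<W> \<Longrightarrow> vsubmodule V M W" "\<W> \<noteq> {}"
  shows "vsubmodule V M (\<Inter>\<W>)"
  using assms unfolding vsubmodule_def by (fast intro: cvs.subspace_Inter[rule_format])

text \<open>Any two elements of the union lie in a common member of the chain. This supplies the
  upper bounds for Zorn's lemma.\<close>

lemma vsubmodule_Union_chain:
  assumes "\<And>W. W \<in> \<W> \<Longrightarrow> vsubmodule V M W" "\<W> \<noteq> {}"
    and chain: "\<And>W W'. W \<in> \<W> \<Longrightarrow> W' \<in> \<W> \<Longrightarrow> W \<subseteq> W' \<or> W' \<subseteq> W"
  shows "vsubmodule V M (\<Union>\<W>)"
  unfolding vsubmodule_def cvs.subspace_def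
proof (intro conjI ballI allI)
  show "0 \<in> \<Union>\<W>" using assms(1,2) cvs.subspace_0 vsubmodule_subspace by blast
  fix u v assume "u \<in> \<Union>\<W>" "v \<in> \<Union>\<W>"
  then obtain W where "W \<in> \<W>" "u \<in> W" "v \<in> W" using chain by blast
  then show "u + v \<in> \<Union>\<W>" using assms(1) cvs.subspace_add vsubmodule_subspace by blast
next
  fix c u assume "u \<in> \<Union>\<W>"
  then show "c *\<^sub>C u \<in> \<Union>\<W>" using assms(1) cvs.subspace_scale vsubmodule_subspace by blast
next
  show "\<Union>\<W> \<subseteq> vcar M" using assms(1) vsubmodule_subset by blast
  show "mprod M a n ` \<Union>\<W> \<subseteq> \<Union>\<W>" for a n
    using assms(1) vsubmodule_mprod by blast
qed

section \<open>Action of the Cartan subalgebra and of L_0\<close>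

locale affine_va =
  fixes l :: nat and k :: complex and V :: "'v::complex_vector vertex_alg"
    and \<iota> :: "complex mat \<Rightarrow> 'v"
  assumes affine: "affine_vertex_algebra l k V \<iota>"
begin

text \<open>Regarding \<open>V\<close> as a module over itself makes every fact about
  \<open>mprod\<close> available for \<open>nprod\<close>.\<close>

abbreviation adjoint :: "('v, 'v) vmod" where
  "adjoint \<equiv> \<lparr>vcar = UNIV, mprod = nprod V\<rparr>"

abbreviation aff :: "('v, 'm::complex_vector) vmod \<Rightarrow> 'm affine_mod" where
  "aff M \<equiv> underlying l k V \<iota> M"

lemma adjoint_module: "vertex_module V adjoint"
  using affine by (simp add: affine_vertex_algebra_def vertex_algebra_def)

lemma nprod_truncated: "\<exists>N. \<forall>n\<ge>N. nprod V a n b = 0"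
  using mprod_truncated[OF adjoint_module] by simp

lemma iota_scale: "x \<in> so_alg l \<Longrightarrow> \<iota> (c \<cdot>\<^sub>m x) = c *\<^sub>C \<iota> x"
  and nprod_iota_zero: "x \<in> so_alg l \<Longrightarrow> y \<in> so_alg l \<Longrightarrow> nprod V (\<iota> x) 0 (\<iota> y) = \<iota> (lie x y)"
  using affine by (auto simp: affine_vertex_algebra_def)

lemma cartan_sugawara:
  assumes H: "H \<in> cartan l"
  shows "nprod V (\<iota> H) 0 (sugawara l k V \<iota>) = 0"
proof -
  let ?g = "so_gen l"
  let ?D = "nprod V (\<iota> H) 0"
  have Hso: "H \<in> so_alg l" using H by (simp add: cartan_def)
  note lin = mprod_add[OF adjoint_module, simplified] mprod_scale[OF adjoint_module, simplified]
    mprod_add_left[OF adjoint_module, simplified] mprod_scale_left[OF adjoint_module, simplified]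
    mprod_sum[OF adjoint_module, simplified]
  have Dg: "?D (\<iota> (?g i j)) = (H $$ (i, i) - H $$ (j, j)) *\<^sub>C \<iota> (?g i j)"
    if "i < 2*l" "j < 2*l" for i j
    using that so_gen_in_so_alg[OF that]
    by (simp add: nprod_iota_zero Hso lie_cartan_so_gen[OF H] iota_scale)
  have "?D (nprod V (\<iota> (?g i j)) (-1) (\<iota> (?g j i))) = 0" if ij: "i < 2*l" "j < 2*l" for i j
  proof -
    let ?a = "\<iota> (?g i j)" and ?b = "\<iota> (?g j i)"
    have "?D (nprod V ?a (-1) ?b) = nprod V (?D ?a) (-1) ?b + nprod V ?a (-1) (?D ?b)"
      using zero_mode_commutator[OF adjoint_module, of ?b "\<iota> H" ?a "-1"] by (simp add: algebra_simps)
    \<comment> \<open>The two factors have eigenvalues \<open>H $$ (i, i) - H $$ (j, j)\<close> and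
      its negative.\<close>
    also have "\<dots> = 0"
      using ij by (simp add: Dg lin flip: cvs.scale_left_distrib)
    finally show ?thesis .
  qed
  then show ?thesis by (simp add: sugawara_def lin)
qed

lemma cartan_op_aff:
  "cartan_op (aff M) H a b v =
     mprod M (\<iota> H) 0 v + (a * k) *\<^sub>C v - b *\<^sub>C mprod M (sugawara l k V \<iota>) 1 v"
  by (simp add: cartan_op_def underlying_def)

lemma cartan_op_add:
  "vertex_module V M \<Longrightarrow> u \<in> vcar M \<Longrightarrow> v \<in> vcar M \<Longrightarrow>
    cartan_op (aff M) H a b (u + v) = cartan_op (aff M) H a b u + cartan_op (aff M) H a b v"
  by (simp add: cartan_op_aff mprod_add scaleC_add_right)

lemma cartan_op_scale:
  "vertex_module V M \<Longrightarrow> v \<in> vcar M \<Longrightarrow>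
    cartan_op (aff M) H a b (c *\<^sub>C v) = c *\<^sub>C cartan_op (aff M) H a b v"
  by (simp add: cartan_op_aff mprod_scale scaleC_add_right cvs.scale_right_diff_distrib
      scaleC_scaleC mult_ac)

lemma cartan_op_closed:
  assumes "vsubmodule V M U" "v \<in> U"
  shows "cartan_op (aff M) H a b v \<in> U"
  using assms vsubmodule_subspace[OF assms(1)]
  by (auto simp: cartan_op_aff vsubmodule_mprod
      intro!: cvs.subspace_add cvs.subspace_scale cvs.subspace_diff)

text \<open>Both operators are combinations of a zero mode, the identity and L_0. The zero modes
  commute because [H, H'] = 0, and they commute with L_0 because they annihilate the Sugawara
  vector.\<close>

lemma cartan_op_commute:
  assumes M: "vertex_module V M" and H: "H \<in> cartan l" "H' \<in> cartan l" and v: "v \<in> vcar M"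
  shows "cartan_op (aff M) H a b (cartan_op (aff M) H' a' b' v) =
    cartan_op (aff M) H' a' b' (cartan_op (aff M) H a b v)"
proof -
  define X Y W where "X = mprod M (\<iota> H) 0" and "Y = mprod M (\<iota> H') 0"
    and "W = mprod M (sugawara l k V \<iota>) 1"
  have so: "H \<in> so_alg l" "H' \<in> so_alg l" using H by (auto simp: cartan_def)
  have "X (Y v) - Y (X v) = mprod M (\<iota> (0 \<cdot>\<^sub>m H')) 0 v"
    using zero_mode_commutator[OF M v, of "\<iota> H" "\<iota> H'" 0] so
    by (simp add: X_def Y_def nprod_iota_zero lie_cartan_cartan[OF H])
  then have XY: "X (Y v) = Y (X v)"
    using so v by (simp add: iota_scale mprod_zero_left[OF M])
  have XW: "X (W v) = W (X v)" and YW: "Y (W v) = W (Y v)"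
    using zero_mode_commutator[OF M v, of "\<iota> H" "sugawara l k V \<iota>" 1]
      zero_mode_commutator[OF M v, of "\<iota> H'" "sugawara l k V \<iota>" 1]
    by (simp_all add: X_def Y_def W_def cartan_sugawara H mprod_zero_left[OF M v])
  have cl: "X v \<in> vcar M" "Y v \<in> vcar M" "W v \<in> vcar M"
    using v by (auto simp: X_def Y_def W_def mprod_closed[OF M])
  note sub = vertex_module_subspace[OF M]
  have X: "cartan_op (aff M) H a b u = X u + (a * k) *\<^sub>C u + (- b) *\<^sub>C W u" for u a b
    by (simp add: cartan_op_aff X_def W_def)
  have Y: "cartan_op (aff M) H' a b u = Y u + (a * k) *\<^sub>C u + (- b) *\<^sub>C W u" for u a b
    by (simp add: cartan_op_aff Y_def W_def)
  have lin: "Z (u + u') = Z u + Z u'" "Z (c *\<^sub>C u) = c *\<^sub>C Z u"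
    if "Z \<in> {X, Y, W}" "u \<in> vcar M" "u' \<in> vcar M" for Z u u' c
    using that by (auto simp: X_def Y_def W_def mprod_add[OF M] mprod_scale[OF M])
  show ?thesis
    unfolding X Y
    using cl v
    by (simp add: lin cvs.subspace_add[OF sub] cvs.subspace_scale[OF sub] XY XW YW
        scaleC_add_right scaleC_scaleC cvs.subspace_neg[OF sub] add_ac mult_ac
        del: cvs.scale_minus_left)
qed

lemma commuting_cartan_ops:
  assumes M: "vertex_module V M"
  shows "commuting_ops (vcar M) (cartan l \<times> UNIV) (\<lambda>(H, a, b). cartan_op (aff M) H a b)"
proof
  show "cvs.subspace (vcar M)" by (rule vertex_module_subspace[OF M])
qed (auto simp: linear_on_def cartan_op_add[OF M] cartan_op_scale[OF M] cartan_op_commute[OF M]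
    intro: cartan_op_closed[OF vsubmodule_full[OF M]])

lemma gen_weight_space_eq:
  assumes M: "vertex_module V M"
  shows "gen_weight_space l (aff M) \<nu> =
    commuting_ops.joint_gen_eigenspace (vcar M) (cartan l \<times> UNIV)
      (\<lambda>(H, a, b). cartan_op (aff M) H a b) (\<lambda>(H, a, b). weval l \<nu> H a b)"
  unfolding gen_weight_space_def commuting_ops.joint_gen_eigenspace_def[OF commuting_cartan_ops[OF M]]
    commuting_ops.shift_def[OF commuting_cartan_ops[OF M]]
  by (auto simp: underlying_def)

lemma gen_weight_space_subspace:
  "vertex_module V M \<Longrightarrow> cvs.subspace (gen_weight_space l (aff M) \<nu>)"
  by (simp add: gen_weight_space_eq commuting_ops.joint_gen_eigenspace_subspace[OF commuting_cartan_ops])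

text \<open>Distinct elements of \<open>hdual l\<close> are distinct functionals on the Cartan
  subalgebra, so the independence of joint generalized eigenspaces applies.\<close>

lemma gen_weight_spaces_independent:
  assumes M: "vertex_module V M" and F: "finite F" "F \<subseteq> hdual l"
    and x: "\<And>\<mu>. \<mu> \<in> F \<Longrightarrow> x \<mu> \<in> gen_weight_space l (aff M) \<mu>"
    and "(\<Sum>\<mu>\<in>F. x \<mu>) = 0" and "\<mu> \<in> F"
  shows "x \<mu> = 0"
proof -
  have "\<forall>\<mu>\<in>F. x \<mu> = 0"
  proof (rule commuting_ops.joint_gen_eigenspaces_independent[OF commuting_cartan_ops[OF M] F(1)])
    show "x \<mu> \<in> commuting_ops.joint_gen_eigenspace (vcar M) (cartan l \<times> UNIV)
      (\<lambda>(H, a, b). cartan_op (aff M) H a b) (\<lambda>(H, a, b). weval l \<mu> H a b)" if "\<mu> \<in> F" for \<mu>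
      using x[OF that] by (simp add: gen_weight_space_eq[OF M])
    show "\<exists>i\<in>cartan l \<times> UNIV. (\<lambda>(H, a, b). weval l \<mu> H a b) i \<noteq> (\<lambda>(H, a, b). weval l \<nu> H a b) i"
      if "\<mu> \<in> F" "\<nu> \<in> F" "\<mu> \<noteq> \<nu>" for \<mu> \<nu>
      using weval_separates[of \<mu> l \<nu>] that F(2) by auto
  qed (fact assms(5))
  with \<open>\<mu> \<in> F\<close> show ?thesis by blast
qed

end


section \<open>Subquotients\<close>

text \<open>The quotient \<open>U / N\<close>, realised on the complement \<open>p ` U\<close> of \<open>N\<close>.\<close>

locale vertex_subquotient = affine_va l k V \<iota>
  for l k and V :: "'v::complex_vector vertex_alg" and \<iota> +
  fixes M :: "('v, 'm::complex_vector) vmod" and U N :: "'m set" and p :: "'m \<Rightarrow> 'm"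
  assumes M: "vertex_module V M" and U: "vsubmodule V M U" and N: "vsubmodule V M N"
    and N_subset: "N \<subseteq> U"
    and p_linear: "linear_on UNIV p"
    and p_zero_on: "u \<in> N \<Longrightarrow> p u = 0"
    and p_diff: "u - p u \<in> N"
begin

text \<open>Each mode is followed by \<open>p\<close> because the complement of \<open>N\<close>
  need not be stable under the modes of \<open>M\<close>.\<close>

definition Q :: "('v, 'm) vmod" where
  "Q = \<lparr>vcar = p ` U, mprod = (\<lambda>a n v. p (mprod M a n v))\<rparr>"

lemma Q_sel [simp]: "vcar Q = p ` U" "mprod Q a n v = p (mprod M a n v)"
  by (simp_all add: Q_def)

lemma p_add: "p (u + v) = p u + p v" and p_scale: "p (c *\<^sub>C u) = c *\<^sub>C p u"
  using p_linear by (auto simp: linear_on_def)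

lemma p_zero: "p 0 = 0"
  using p_scale[of 0 0] by simp

lemma p_neg: "p (- u) = - p u"
  using p_scale[of "-1" u] by (simp add: scaleC_one)

lemma p_minus: "p (u - v) = p u - p v"
  using p_add[of u "- v"] by (simp add: p_neg)

lemma p_sum: "p (\<Sum>x\<in>F. g x) = (\<Sum>x\<in>F. p (g x))"
  by (induction F rule: infinite_finite_induct) (auto simp: p_zero p_add)

text \<open>Finite support matters: \<open>Sum_any\<close> is 0 on a family of infinite support,
  whose image under \<open>p\<close> may well have finite support.\<close>

lemma p_Sum_any:
  fixes g :: "nat \<Rightarrow> 'm"
  assumes "finite {j. g j \<noteq> 0}"
  shows "p (Sum_any g) = Sum_any (\<lambda>j. p (g j))"
proof -
  have "Sum_any (\<lambda>j. p (g j)) = (\<Sum>j\<in>{j. g j \<noteq> 0}. p (g j))"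
    by (rule Sum_any.expand_superset) (use assms in \<open>auto simp: p_zero\<close>)
  then show ?thesis by (simp add: Sum_any.expand_set p_sum)
qed

lemma p_in_U: "u \<in> U \<Longrightarrow> p u \<in> U"
  using cvs.subspace_diff[OF vsubmodule_subspace[OF U], of u "u - p u"] p_diff[of u] N_subset by auto

lemma p_eq_0_iff: "p u = 0 \<longleftrightarrow> u \<in> N"
  using p_diff[of u] p_zero_on[of u] by auto

lemma p_idem: "p (p u) = p u"
  using p_zero_on[OF p_diff[of u]] by (simp add: p_minus)

lemma U_carrier: "u \<in> U \<Longrightarrow> u \<in> vcar M"
  using vsubmodule_subset[OF U] by auto

text \<open>The action on the quotient is well defined: \<open>u\<close> and \<open>p u\<close>
  differ by an element of the submodule \<open>N\<close>.\<close>

lemma p_mprod: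
  assumes "u \<in> U"
  shows "p (mprod M a n (p u)) = p (mprod M a n u)"
proof -
  have "p (mprod M a n (u - p u)) = 0"
    using vsubmodule_mprod[OF N p_diff] by (rule p_zero_on)
  then show ?thesis
    using assms by (simp add: mprod_diff[OF M] U_carrier p_in_U p_minus)
qed

lemma vertex_module_Q: "vertex_module V Q"
  unfolding vertex_module_def
proof (intro conjI allI ballI)
  have sub: "cvs.subspace U" by (rule vsubmodule_subspace[OF U])
  show "cvs.subspace (vcar Q)"
    unfolding cvs.subspace_def Q_sel
    using cvs.subspace_0[OF sub] cvs.subspace_add[OF sub] cvs.subspace_scale[OF sub]
    by (auto simp: image_iff simp flip: p_add p_scale) (metis p_zero)
  show "mprod Q a n ` vcar Q \<subseteq> vcar Q" for a n
    by (auto simp: p_mprod vsubmodule_mprod[OF U])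
  show "linear_on (vcar Q) (mprod Q a n)" for a n
    unfolding linear_on_def
    by (auto simp: mprod_add[OF M] mprod_scale[OF M] U_carrier p_in_U p_add p_scale)
  fix v assume "v \<in> vcar Q"
  then have v: "v \<in> U" "v \<in> vcar M" "p v = v" by (auto simp: p_in_U p_idem U_carrier)
  show "linear_on UNIV (\<lambda>a. mprod Q a n v)" for n
    unfolding linear_on_def
    by (auto simp: mprod_add_left[OF M] mprod_scale_left[OF M] v p_add p_scale)
  show "\<exists>N. \<forall>n\<ge>N. mprod Q a n v = 0" for a
    using mprod_truncated[OF M v(2), of a] by (metis Q_sel(2) p_zero)
  show "mprod Q (vac V) n v = (if n = - 1 then v else 0)" for n
    using mprod_vac[OF M v(2), of n] by (auto simp: p_zero v)
  show "borcherds_at V (mprod Q) v"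
    unfolding borcherds_at_def
  proof (intro allI)
    fix a b m n k'
    let ?f = "\<lambda>j::nat. (of_int m gchoose j) *\<^sub>C
        mprod M (nprod V a (n + int j) b) (m + k' - int j) v"
    let ?g = "\<lambda>j::nat. ((-1) ^ j * (of_int n gchoose j)) *\<^sub>C
        (mprod M a (m + n - int j) (mprod M b (k' + int j) v)
         - ((-1) powi n) *\<^sub>C mprod M b (n + k' - int j) (mprod M a (m + int j) v))"
    have fin: "finite {j. h j \<noteq> 0}" if "\<And>j. int j \<ge> A \<Longrightarrow> h j = 0" for h :: "nat \<Rightarrow> 'm" and A
      by (rule finite_subset[of _ "{..nat A}"]) (use that in \<open>force simp: not_le\<close>)+
    \<comment> \<open>These truncation bounds make both sums finite, the left one from j = A - n on
      and the right one from j = max (B - k') (C - m) on. Hence \<open>p\<close> may be applied term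
      by term to the identity in \<open>M\<close>.\<close>
    obtain A where A: "\<And>j. j \<ge> A \<Longrightarrow> nprod V a j b = 0" using nprod_truncated by blast
    obtain B where B: "\<And>j. j \<ge> B \<Longrightarrow> mprod M b j v = 0" using mprod_truncated[OF M v(2)] by blast
    obtain C where C: "\<And>j. j \<ge> C \<Longrightarrow> mprod M a j v = 0" using mprod_truncated[OF M v(2)] by blast
    have "finite {j. ?f j \<noteq> 0}"
      by (rule fin[of "A - n"]) (simp add: A mprod_zero_left[OF M v(2)])
    moreover have "finite {j. ?g j \<noteq> 0}"
      by (rule fin[of "max (B - k') (C - m)"]) (simp add: B C mprod_zero[OF M])
    moreover have "Sum_any ?f = Sum_any ?g"
      using mprod_borcherds[OF M v(2)] unfolding borcherds_at_def by blast
    ultimately have "Sum_any (\<lambda>j. p (?f j)) = Sum_any (\<lambda>j. p (?g j))"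
      by (simp flip: p_Sum_any)
    then show "Sum_any (\<lambda>j::nat. (of_int m gchoose j) *\<^sub>C
        mprod Q (nprod V a (n + int j) b) (m + k' - int j) v) =
     Sum_any (\<lambda>j::nat. ((-1) ^ j * (of_int n gchoose j)) *\<^sub>C
        (mprod Q a (m + n - int j) (mprod Q b (k' + int j) v)
         - ((-1) powi n) *\<^sub>C mprod Q b (n + k' - int j) (mprod Q a (m + int j) v)))"
      using v(1) by (simp add: p_scale p_minus p_mprod vsubmodule_mprod[OF U])
  qed
qed

section \<open>Weight spaces and linkage under passage to a subquotient\<close>

lemma p_cartan_op:
  "u \<in> U \<Longrightarrow> cartan_op (aff Q) H a b (p u) = p (cartan_op (aff M) H a b u)"
  by (simp add: cartan_op_aff p_mprod p_add p_scale p_minus)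

lemma p_gen_weight_space:
  assumes u: "u \<in> U" "u \<in> gen_weight_space l (aff M) \<mu>"
  shows "p u \<in> gen_weight_space l (aff Q) \<mu>"
  unfolding gen_weight_space_def
proof (intro CollectI conjI ballI allI)
  show "p u \<in> acar (aff Q)" using u by (simp add: underlying_def)
  fix H a b assume "H \<in> cartan l"
  let ?S = "\<lambda>u. cartan_op (aff M) H a b u - weval l \<mu> H a b *\<^sub>C u"
  let ?S' = "\<lambda>u. cartan_op (aff Q) H a b u - weval l \<mu> H a b *\<^sub>C u"
  obtain n where n: "(?S ^^ n) u = 0"
    using u(2) \<open>H \<in> cartan l\<close> unfolding gen_weight_space_def by blast
  \<comment> \<open>Membership in \<open>U\<close> is carried along because \<open>p\<close>
    intertwines the Cartan operators only on \<open>U\<close>.\<close>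
  have "(?S ^^ n) u \<in> U \<and> (?S' ^^ n) (p u) = p ((?S ^^ n) u)" for n
    by (induction n)
      (use u(1) vsubmodule_subspace[OF U] in \<open>auto simp: p_cartan_op p_minus p_scale
        intro!: cvs.subspace_diff cvs.subspace_scale cartan_op_closed[OF U]\<close>)
  with n show "\<exists>n. (?S' ^^ n) (p u) = 0" by (metis p_zero)
qed

text \<open>A subquotient of a subquotient is a subquotient: the submodule is pulled back along
  \<open>p\<close> and the homomorphism composed with \<open>p\<close>.\<close>

lemma in_linkage_block_Q:
  assumes "in_linkage_block l \<nu> (aff M)"
  shows "in_linkage_block l \<nu> (aff Q)"
proof -
  have "affine_subquotient l (aff M) S" if S: "affine_subquotient l (aff Q) S" for S :: "'m affine_mod"
  proof -
    obtain U' f where U': "affine_submodule l (aff Q) U'" and f: "linear_on U' f" "f ` U' = acar S"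
      and hom: "\<And>u. u \<in> U' \<Longrightarrow> (\<forall>x\<in>so_alg l. \<forall>n. f (loop (aff Q) x n u) = loop S x n (f u)) \<and>
                f (cent (aff Q) u) = cent S (f u) \<and> f (der (aff Q) u) = der S (f u)"
      using S by (auto simp: affine_subquotient_def)
    let ?W = "{u \<in> U. p u \<in> U'}"
    have U'sub: "cvs.subspace U'" "U' \<subseteq> p ` U"
      and U'cl: "\<And>x n u. x \<in> so_alg l \<Longrightarrow> u \<in> U' \<Longrightarrow> p (mprod M (\<iota> x) n u) \<in> U'"
        "\<And>u. u \<in> U' \<Longrightarrow> - p (mprod M (sugawara l k V \<iota>) 1 u) \<in> U'"
      using U' by (auto simp: affine_submodule_def underlying_def image_subset_iff)
    have Usub: "cvs.subspace U" by (rule vsubmodule_subspace[OF U])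
    have loop: "loop (aff M) x n u \<in> ?W" "p (loop (aff M) x n u) = loop (aff Q) x n (p u)"
      if "u \<in> ?W" "x \<in> so_alg l" for x n u
      using U'cl(1)[OF that(2), of "p u" n] that by (auto simp: underlying_def p_mprod vsubmodule_mprod[OF U])
    have cent: "cent (aff M) u \<in> ?W" "p (cent (aff M) u) = cent (aff Q) (p u)" if "u \<in> ?W" for u
      using that cvs.subspace_scale[OF Usub] cvs.subspace_scale[OF U'sub(1)]
      by (auto simp: underlying_def p_scale)
    have der: "der (aff M) u \<in> ?W" "p (der (aff M) u) = der (aff Q) (p u)" if "u \<in> ?W" for u
      using that U'cl(2)[of "p u"] cvs.subspace_neg[OF Usub]
      by (auto simp: underlying_def p_mprod p_neg vsubmodule_mprod[OF U])
    have "cvs.subspace ?W"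
      using Usub U'sub(1) by (auto simp: cvs.subspace_def p_add p_scale p_zero)
    then have "affine_submodule l (aff M) ?W"
      using loop(1) cent(1) der(1) U_carrier unfolding affine_submodule_def
      by (auto simp: underlying_def image_subset_iff)
    moreover have "linear_on ?W (f \<circ> p)"
      using f(1) by (auto simp: linear_on_def p_add p_scale)
    moreover have "p ` ?W = U'" using U'sub(2) by auto
    then have "(f \<circ> p) ` ?W = acar S" using f(2) by (metis image_comp)
    moreover have "\<forall>u\<in>?W. (\<forall>x\<in>so_alg l. \<forall>n. (f \<circ> p) (loop (aff M) x n u) = loop S x n ((f \<circ> p) u)) \<and>
                (f \<circ> p) (cent (aff M) u) = cent S ((f \<circ> p) u) \<and> (f \<circ> p) (der (aff M) u) = der S ((f \<circ> p) u)"
      using hom loop(2) cent(2) der(2) by simp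
    ultimately show ?thesis using S unfolding affine_subquotient_def by blast
  qed
  then show ?thesis using assms by (auto simp: in_linkage_block_def)
qed

end

context affine_va
begin

text \<open>In the quotient of \<open>M\<close> by \<open>W\<close> the images of the components are
  generalized weight vectors of distinct weights with sum zero. Independence makes them
  vanish.\<close>

lemma weight_components_in_submodule:
  fixes M :: "('v, 'm::complex_vector) vmod"
  assumes M: "vertex_module V M" and W: "vsubmodule V M W" and F: "finite F" "F \<subseteq> hdual l"
    and f: "\<And>\<mu>. \<mu> \<in> F \<Longrightarrow> f \<mu> \<in> gen_weight_space l (aff M) \<mu>"
    and sum: "(\<Sum>\<mu>\<in>F. f \<mu>) \<in> W" and "\<mu> \<in> F"
  shows "f \<mu> \<in> W"
proof -
  obtain p :: "'m \<Rightarrow> 'm" where p: "linear_on UNIV p" "\<And>u. u \<in> W \<Longrightarrow> p u = 0" "\<And>u. u - p u \<in> W"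
    using projection_along_subspace[OF vsubmodule_subspace[OF W]] by blast
  interpret quot: vertex_subquotient l k V \<iota> M "vcar M" W p
    by unfold_locales (use M W p vsubmodule_full[OF M] vsubmodule_subset[OF W] in auto)
  have "p (f \<mu>) = 0"
  proof (rule gen_weight_spaces_independent[OF quot.vertex_module_Q F])
    show "p (f \<kappa>) \<in> gen_weight_space l (aff quot.Q) \<kappa>" if "\<kappa> \<in> F" for \<kappa>
      using f[OF that] by (intro quot.p_gen_weight_space) (auto simp: gen_weight_space_def underlying_def)
    show "(\<Sum>\<kappa>\<in>F. p (f \<kappa>)) = 0" using p(2)[OF sum] by (simp add: quot.p_sum)
  qed fact
  then show ?thesis by (simp add: quot.p_eq_0_iff)
qed

end

context vertex_subquotient
begin

context
  assumes decomposed: "gen_weight_decomposed l (aff M)"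
begin

lemma weight_decomposition:
  assumes u: "u \<in> U"
  obtains f where "\<And>\<mu>. \<mu> \<in> hdual l \<Longrightarrow> f \<mu> \<in> gen_weight_space l (aff M) \<mu>"
    "\<And>\<mu>. \<mu> \<notin> hdual l \<Longrightarrow> f \<mu> = 0" "finite {\<mu>. f \<mu> \<noteq> 0}" "u = (\<Sum>\<mu> | f \<mu> \<noteq> 0. f \<mu>)"
    "\<And>\<mu>. f \<mu> \<in> U"
proof -
  have "u \<in> acar (aff M)" using u U_carrier by (simp add: underlying_def)
  then obtain f where f: "\<And>\<mu>. \<mu> \<in> hdual l \<Longrightarrow> f \<mu> \<in> gen_weight_space l (aff M) \<mu>"
    "\<And>\<mu>. \<mu> \<notin> hdual l \<Longrightarrow> f \<mu> = 0" "finite {\<mu>. f \<mu> \<noteq> 0}" "u = (\<Sum>\<mu> | f \<mu> \<noteq> 0. f \<mu>)"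
    using decomposed unfolding gen_weight_decomposed_def by blast
  have "f \<mu> \<in> U" for \<mu>
  proof (cases "f \<mu> = 0")
    case False
    have supp: "{\<mu>. f \<mu> \<noteq> 0} \<subseteq> hdual l" using f(2) by blast
    have "(\<Sum>\<mu> | f \<mu> \<noteq> 0. f \<mu>) \<in> U" using u f(4) by simp
    then show ?thesis
      by (rule weight_components_in_submodule[OF M U f(3) supp, rotated]) (use f(1) supp False in blast)+
  qed (simp add: cvs.subspace_0[OF vsubmodule_subspace[OF U]])
  with f that show ?thesis by blast
qed

text \<open>The components of a preimage in \<open>U\<close> again lie in \<open>U\<close> and
  project to components of \<open>q\<close>. Uniqueness is independence applied to
  differences.\<close>

lemma gen_weight_decomposed_Q: "gen_weight_decomposed l (aff Q)"
  unfolding gen_weight_decomposed_def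
proof
  fix q assume "q \<in> acar (aff Q)"
  then obtain u where u: "u \<in> U" "q = p u" by (auto simp: underlying_def)
  obtain f where f: "\<And>\<mu>. \<mu> \<in> hdual l \<Longrightarrow> f \<mu> \<in> gen_weight_space l (aff M) \<mu>"
    "\<And>\<mu>. \<mu> \<notin> hdual l \<Longrightarrow> f \<mu> = 0" "finite {\<mu>. f \<mu> \<noteq> 0}" "u = (\<Sum>\<mu> | f \<mu> \<noteq> 0. f \<mu>)"
    "\<And>\<mu>. f \<mu> \<in> U"
    using weight_decomposition[OF u(1)] by blast
  let ?P = "\<lambda>g. (\<forall>\<nu>\<in>hdual l. g \<nu> \<in> gen_weight_space l (aff Q) \<nu>) \<and> (\<forall>\<nu>. \<nu> \<notin> hdual l \<longrightarrow> g \<nu> = 0) \<and>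
     finite {\<nu>. g \<nu> \<noteq> 0} \<and> q = (\<Sum>\<nu> | g \<nu> \<noteq> 0. g \<nu>)"
  show "\<exists>!g. ?P g"
  proof (rule ex1I)
    have supp: "{\<nu>. p (f \<nu>) \<noteq> 0} \<subseteq> {\<nu>. f \<nu> \<noteq> 0}" by (auto simp: p_zero)
    have "q = (\<Sum>\<nu> | f \<nu> \<noteq> 0. p (f \<nu>))" using u(2) f(4) by (metis p_sum)
    also have "\<dots> = (\<Sum>\<nu> | p (f \<nu>) \<noteq> 0. p (f \<nu>))"
      by (rule sum.mono_neutral_right) (use f(3) supp in auto)
    finally show "?P (\<lambda>\<nu>. p (f \<nu>))"
      using f finite_subset[OF supp] by (auto simp: p_zero p_gen_weight_space)
  next
    fix g assume g: "?P g"
    \<comment> \<open>Both expansions of \<open>q\<close> are rewritten as sums over the union of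
      the supports before being subtracted.\<close>
    let ?F = "{\<nu>. f \<nu> \<noteq> 0} \<union> {\<nu>. g \<nu> \<noteq> 0}"
    have F: "finite ?F" "?F \<subseteq> hdual l" using f(2,3) g by (simp, blast)
    have "q = (\<Sum>\<nu>\<in>?F. g \<nu>)" using g F(1) by (auto intro: sum.mono_neutral_left)
    moreover have "q = (\<Sum>\<nu>\<in>?F. p (f \<nu>))"
    proof -
      have "q = (\<Sum>\<nu> | f \<nu> \<noteq> 0. p (f \<nu>))" using u(2) f(4) by (metis p_sum)
      also have "\<dots> = (\<Sum>\<nu>\<in>?F. p (f \<nu>))"
        using F(1) by (intro sum.mono_neutral_left) (auto simp: p_zero)
      finally show ?thesis .
    qed
    ultimately have sum: "(\<Sum>\<nu>\<in>?F. g \<nu> - p (f \<nu>)) = 0" by (simp add: sum_subtractf)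
    have "g \<nu> - p (f \<nu>) = 0" if "\<nu> \<in> ?F" for \<nu>
    proof (rule gen_weight_spaces_independent[OF vertex_module_Q F _ sum that])
      fix \<kappa> assume "\<kappa> \<in> ?F"
      then have "\<kappa> \<in> hdual l" using F by auto
      then show "g \<kappa> - p (f \<kappa>) \<in> gen_weight_space l (aff Q) \<kappa>"
        using g f by (intro cvs.subspace_diff[OF gen_weight_space_subspace[OF vertex_module_Q]])
          (auto simp: p_gen_weight_space)
    qed
    then have "g \<nu> = p (f \<nu>)" for \<nu> by (cases "\<nu> \<in> ?F") (auto simp: p_zero)
    then show "g = (\<lambda>\<nu>. p (f \<nu>))" by blast
  qed
qed

text \<open>Weight vectors of the quotient lift to weight vectors: of any preimage, the component of
  weight \<nu> already maps to \<open>q\<close>. Truncation covers weights outside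
  \<open>hdual l\<close>.\<close>

lemma gen_weight_space_Q: "gen_weight_space l (aff Q) \<nu> = p ` (U \<inter> gen_weight_space l (aff M) \<nu>)"
proof
  let ?\<nu> = "truncate_weight l \<nu>"
  show "p ` (U \<inter> gen_weight_space l (aff M) \<nu>) \<subseteq> gen_weight_space l (aff Q) \<nu>"
    using p_gen_weight_space by blast
  show "gen_weight_space l (aff Q) \<nu> \<subseteq> p ` (U \<inter> gen_weight_space l (aff M) \<nu>)"
  proof
    fix q assume q: "q \<in> gen_weight_space l (aff Q) \<nu>"
    then have q': "q \<in> gen_weight_space l (aff Q) ?\<nu>" by (simp add: gen_weight_space_truncate_weight)
    obtain u where u: "u \<in> U" "q = p u" using q by (auto simp: gen_weight_space_def underlying_def)
    obtain f where f: "\<And>\<mu>. \<mu> \<in> hdual l \<Longrightarrow> f \<mu> \<in> gen_weight_space l (aff M) \<mu>"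
      "\<And>\<mu>. \<mu> \<notin> hdual l \<Longrightarrow> f \<mu> = 0" "finite {\<mu>. f \<mu> \<noteq> 0}" "u = (\<Sum>\<mu> | f \<mu> \<noteq> 0. f \<mu>)"
      "\<And>\<mu>. f \<mu> \<in> U"
      using weight_decomposition[OF u(1)] by blast
    \<comment> \<open>The weight is inserted because the component of \<open>u\<close> there may be
      zero.\<close>
    let ?F = "insert ?\<nu> {\<mu>. f \<mu> \<noteq> 0}"
    have F: "finite ?F" "?F \<subseteq> hdual l" using f(2,3) truncate_weight_in_hdual by (simp, blast)
    have "u = (\<Sum>\<mu>\<in>?F. f \<mu>)" using f(3,4) F(1) by (auto intro: sum.mono_neutral_left)
    then have "q = (\<Sum>\<mu>\<in>?F. p (f \<mu>))" using u(2) by (simp only: p_sum)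
    moreover have "q = (\<Sum>\<mu>\<in>?F. if \<mu> = ?\<nu> then q else 0)" using F(1) by simp
    ultimately have sum: "(\<Sum>\<mu>\<in>?F. (if \<mu> = ?\<nu> then q else 0) - p (f \<mu>)) = 0"
      by (simp only: sum_subtractf) simp
    have "(if ?\<nu> = ?\<nu> then q else 0) - p (f ?\<nu>) = 0"
    proof (rule gen_weight_spaces_independent[OF vertex_module_Q F _ sum])
      fix \<kappa> assume "\<kappa> \<in> ?F"
      then have "\<kappa> \<in> hdual l" using F by auto
      then show "(if \<kappa> = ?\<nu> then q else 0) - p (f \<kappa>) \<in> gen_weight_space l (aff Q) \<kappa>"
        using q' f cvs.subspace_0[OF gen_weight_space_subspace[OF vertex_module_Q]]
        by (intro cvs.subspace_diff[OF gen_weight_space_subspace[OF vertex_module_Q]])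
          (auto simp: p_gen_weight_space)
    qed simp
    then have "q = p (f ?\<nu>)" by simp
    moreover have "f ?\<nu> \<in> gen_weight_space l (aff M) \<nu>"
      using f(1)[OF truncate_weight_in_hdual] by (simp add: gen_weight_space_truncate_weight)
    ultimately show "q \<in> p ` (U \<inter> gen_weight_space l (aff M) \<nu>)" using f(5) by blast
  qed
qed

lemma gen_weights_finite_dim_Q:
  assumes "gen_weights_finite_dim l (aff M)"
  shows "gen_weights_finite_dim l (aff Q)"
  unfolding gen_weights_finite_dim_def
proof
  fix \<nu> assume "\<nu> \<in> hdual l"
  then obtain B where B: "finite B" "gen_weight_space l (aff M) \<nu> = cvs.span B"
    using assms by (auto simp: gen_weights_finite_dim_def)
  let ?S = "U \<inter> gen_weight_space l (aff M) \<nu>"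
  have S: "cvs.subspace ?S"
    by (simp add: cvs.subspace_inter vsubmodule_subspace[OF U] gen_weight_space_subspace[OF M])
  have "?S \<subseteq> cvs.span B" using B(2) by blast
  then obtain C where C: "C \<subseteq> ?S" "finite C" "cvs.independent C" "?S \<subseteq> cvs.span C" "card C = cvs.dim ?S"
    by (rule finite_dim_subspace[OF B(1)])
  have "?S = cvs.span C" using C S cvs.span_minimal by blast
  moreover interpret pl: Vector_Spaces.linear "scaleC" "scaleC" p
    by unfold_locales (auto simp: p_add p_scale)
  have "p ` cvs.span C = cvs.span (p ` C)" by (simp add: pl.span_image)
  ultimately show "\<exists>B. finite B \<and> gen_weight_space l (aff Q) \<nu> = cvs.span B"
    using C(2) by (auto simp: gen_weight_space_Q)
qed

lemma gen_weights_bounded_Q: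
  assumes "gen_weights_bounded l (aff M)"
  shows "gen_weights_bounded l (aff Q)"
  unfolding gen_weights_bounded_def
proof
  fix \<mu> assume \<mu>: "\<mu> \<in> hdual l"
  have "gen_weight_space l (aff Q) \<nu> = {0}" if "gen_weight_space l (aff M) \<nu> = {0}" for \<nu>
    using cvs.subspace_0[OF vsubmodule_subspace[OF U]] by (simp add: gen_weight_space_Q that p_zero)
  then have "{\<nu>. \<nu> - \<mu> \<in> Q_plus l \<and> gen_weight_space l (aff Q) \<nu> \<noteq> {0}}
      \<subseteq> {\<nu>. \<nu> - \<mu> \<in> Q_plus l \<and> gen_weight_space l (aff M) \<nu> \<noteq> {0}}" by blast
  then show "finite {\<nu>. \<nu> - \<mu> \<in> Q_plus l \<and> gen_weight_space l (aff Q) \<nu> \<noteq> {0}}"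
    using assms \<mu> unfolding gen_weights_bounded_def by (blast intro: finite_subset)
qed

end

text \<open>Submodules of the quotient correspond to submodules of \<open>M\<close> between
  \<open>N\<close> and \<open>U\<close>, by taking preimages under \<open>p\<close>.\<close>

lemma vmod_simple_Q:
  assumes maximal: "\<And>W. vsubmodule V M W \<Longrightarrow> N \<subseteq> W \<Longrightarrow> W \<subseteq> U \<Longrightarrow> W = N \<or> W = U"
    and proper: "N \<noteq> U"
  shows "vmod_simple V Q"
  unfolding vmod_simple_def
proof (intro conjI allI impI)
  show "vcar Q \<noteq> {0}" using proper N_subset p_eq_0_iff by auto
  fix W' assume W': "vsubmodule V Q W'"
  have sub: "W' \<subseteq> p ` U" "cvs.subspace W'" using W' by (auto simp: vsubmodule_def)
  let ?W = "{u \<in> U. p u \<in> W'}"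
  have "p (mprod M a n u) \<in> W'" if "u \<in> ?W" for u a n
    using vsubmodule_mprod[OF W', of "p u" a n] that by (simp add: p_mprod)
  then have "vsubmodule V M ?W"
    using vsubmodule_subspace[OF U] sub(2) U_carrier
    unfolding vsubmodule_def by (auto simp: cvs.subspace_def p_add p_scale p_zero vsubmodule_mprod[OF U])
  moreover have "N \<subseteq> ?W" using N_subset cvs.subspace_0[OF sub(2)] by (auto simp: p_zero_on)
  ultimately have "?W = N \<or> ?W = U" using maximal[of ?W] by blast
  moreover have "p ` ?W = W'" using sub(1) by auto
  moreover have "p ` N = {0}" using p_zero_on cvs.subspace_0[OF vsubmodule_subspace[OF N]] by force
  ultimately show "W' = {0} \<or> W' = vcar Q" by auto
qed

end


section \<open>Chains of submodules\<close>

text \<open>Proper submodules of \<open>B\<close> may have \<open>B\<close> as the union of a chain,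
  but avoiding a fixed vector survives such unions, so Zorn's lemma applies.\<close>

lemma maximal_submodule_avoiding:
  assumes A: "vsubmodule V M A" "A \<subseteq> B" "v \<notin> A"
  obtains N where "vsubmodule V M N" "A \<subseteq> N" "N \<subseteq> B" "v \<notin> N"
    "\<And>W. vsubmodule V M W \<Longrightarrow> N \<subseteq> W \<Longrightarrow> W \<subseteq> B \<Longrightarrow> v \<notin> W \<Longrightarrow> W = N"
proof -
  let ?S = "{W. vsubmodule V M W \<and> A \<subseteq> W \<and> W \<subseteq> B \<and> v \<notin> W}"
  have "\<exists>N\<in>?S. \<forall>X\<in>?S. N \<subseteq> X \<longrightarrow> X = N"
  proof (rule subset_Zorn_nonempty)
    show "?S \<noteq> {}" using A by blast
    fix \<C> assume ne: "\<C> \<noteq> {}" and chain: "subset.chain ?S \<C>"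
    then have "vsubmodule V M (\<Union>\<C>)"
      by (intro vsubmodule_Union_chain) (auto simp: subset_chain_def)
    then show "\<Union>\<C> \<in> ?S" using ne chain by (auto simp: subset_chain_def)
  qed
  then obtain N where N: "N \<in> ?S" "\<forall>X\<in>?S. N \<subseteq> X \<longrightarrow> X = N" by (elim bexE)
  show ?thesis
  proof (rule that[of N])
    fix W assume "vsubmodule V M W" "N \<subseteq> W" "W \<subseteq> B" "v \<notin> W"
    then show "W = N" using N by blast
  qed (use N(1) in auto)
qed

text \<open>The classification of simple objects speaks of modules on subspaces of
  \<open>'m\<close>, which is why the quotient is realised on a complement within that type.\<close>

lemma simple_subquotient_between:
  fixes M :: "('v::complex_vector, 'm::complex_vector) vmod"
  assumes M: "category_C l V \<iota> M" and V: "affine_vertex_algebra l (-1) V \<iota>"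
    and A: "vsubmodule V M A" and B: "vsubmodule V M B" and AB: "A \<subset> B"
    and simples: "\<And>S :: ('v, 'm) vmod. category_C l V \<iota> S \<Longrightarrow> vmod_simple V S \<Longrightarrow>
      \<exists>\<nu>\<in>X. is_L l \<nu> (underlying l (-1) V \<iota> S)"
  shows "\<exists>\<nu>\<in>X. A \<inter> gen_weight_space l (underlying l (-1) V \<iota> M) \<nu>
    \<noteq> B \<inter> gen_weight_space l (underlying l (-1) V \<iota> M) \<nu>"
proof -
  have Mmod: "vertex_module V M" using M by (simp add: category_C_def)
  obtain v where v: "v \<in> B" "v \<notin> A" using AB by auto
  obtain N where N: "vsubmodule V M N" "A \<subseteq> N" "N \<subseteq> B" "v \<notin> N"
    and maximal: "\<And>W. vsubmodule V M W \<Longrightarrow> N \<subseteq> W \<Longrightarrow> W \<subseteq> B \<Longrightarrow> v \<notin> W \<Longrightarrow> W = N"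
    using maximal_submodule_avoiding[OF A, of B v] AB v by (metis psubset_imp_subset)
  define U where "U = \<Inter>{W. vsubmodule V M W \<and> N \<subseteq> W \<and> v \<in> W}"
  have U: "vsubmodule V M U"
    unfolding U_def by (rule vsubmodule_Inter) (use B N(3) v(1) in auto)
  have "U \<subseteq> B" "N \<subseteq> U" "v \<in> U" using B N(3) v(1) by (auto simp: U_def)
  obtain p :: "'m \<Rightarrow> 'm" where p: "linear_on UNIV p" "\<And>u. u \<in> N \<Longrightarrow> p u = 0" "\<And>u. u - p u \<in> N"
    using projection_along_subspace[OF vsubmodule_subspace[OF N(1)]] by blast
  interpret quot: vertex_subquotient l "-1" V \<iota> M U N p
    by unfold_locales (use V Mmod U N(1) \<open>N \<subseteq> U\<close> p in auto)
  \<comment> \<open>A submodule in between either contains \<open>v\<close>, and then all of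
    \<open>U\<close>, or avoids it, and then maximality of \<open>N\<close> applies.\<close>
  have "W = N \<or> W = U" if W: "vsubmodule V M W" "N \<subseteq> W" "W \<subseteq> U" for W
  proof (cases "v \<in> W")
    case True
    then have "U \<subseteq> W" using W by (auto simp: U_def)
    with W show ?thesis by blast
  next
    case False
    then show ?thesis using maximal W \<open>U \<subseteq> B\<close> by blast
  qed
  then have "vmod_simple V quot.Q"
    using quot.vmod_simple_Q N(4) \<open>v \<in> U\<close> by blast
  have decomposed: "gen_weight_decomposed l (quot.aff M)"
    using M by (simp add: category_C_def Let_def)
  have "category_C l V \<iota> quot.Q"
    using M quot.vertex_module_Q quot.in_linkage_block_Q quot.gen_weight_decomposed_Q[OF decomposed]
      quot.gen_weights_finite_dim_Q[OF decomposed] quot.gen_weights_bounded_Q[OF decomposed]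
    by (simp add: category_C_def Let_def)
  then obtain \<nu> where \<nu>: "\<nu> \<in> X" "is_L l \<nu> (quot.aff quot.Q)"
    using simples \<open>vmod_simple V quot.Q\<close> by blast
  then obtain q where q: "is_hw_vector l (quot.aff quot.Q) \<nu> q" by (auto simp: is_L_def)
  have "q \<in> gen_weight_space l (quot.aff quot.Q) \<nu>"
    unfolding gen_weight_space_def
  proof (intro CollectI conjI ballI allI)
    show "\<exists>n. ((\<lambda>u. cartan_op (quot.aff quot.Q) H a b u - weval l \<nu> H a b *\<^sub>C u) ^^ n) q = 0"
      if "H \<in> cartan l" for H a b
      using q that by (intro exI[of _ 1]) (simp add: is_hw_vector_def)
  qed (use q in \<open>simp add: is_hw_vector_def\<close>)
  then obtain u where u: "u \<in> U" "u \<in> gen_weight_space l (quot.aff M) \<nu>" "q = p u"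
    using quot.gen_weight_space_Q[OF decomposed] by auto
  \<comment> \<open>A highest weight vector is nonzero, so its lift lies outside \<open>N\<close>
    and hence outside \<open>A\<close>, while it belongs to \<open>B\<close>.\<close>
  have "u \<notin> N" using q u(3) p(2) by (auto simp: is_hw_vector_def)
  then have "u \<notin> A" "u \<in> B" using N(2) u(1) \<open>U \<subseteq> B\<close> by auto
  with u(2) \<nu>(1) show ?thesis by blast
qed

text \<open>The new term takes position \<open>Suc i\<close> and all later terms move up by one.
  This is used to show that a longest chain admits no refinement.\<close>

lemma submodule_chain_insert:
  assumes C: "submodule_chain V M n C" and i: "i < n"
    and W: "vsubmodule V M W" "C i \<subset> W" "W \<subset> C (Suc i)"
  shows "submodule_chain V M (Suc n) (\<lambda>j. if j \<le> i then C j else if j = Suc i then W else C (j - 1))"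
    (is "submodule_chain V M _ ?D")
proof -
  have "?D j \<subset> ?D (Suc j)" if "j < Suc n" for j
  proof -
    consider "j < i" | "j = i" | "j = Suc i" | j' where "j = Suc j'" "j' > i"
      by (metis Suc_lessI less_Suc_eq_0_disj linorder_neqE_nat not_less0 old.nat.exhaust)
    then show ?thesis
      using C i W that by cases (auto simp: submodule_chain_def)
  qed
  moreover have "vsubmodule V M (?D j)" if "j \<le> Suc n" for j
    using C i W(1) that by (auto simp: submodule_chain_def)
  ultimately show ?thesis using C i by (auto simp: submodule_chain_def)
qed

lemma finite_length_if_chains_bounded:
  assumes M: "vertex_module V M" and bound: "\<And>n C. submodule_chain V M n C \<Longrightarrow> n \<le> d"
  shows "finite_length V M"
proof -
  \<comment> \<open>The zero module is treated separately: inclusions in a chain are strict, so its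
    only chain has length 0.\<close>
  have ex: "\<exists>n C. submodule_chain V M n C"
  proof (cases "vcar M = {0}")
    case True
    then have "submodule_chain V M 0 (\<lambda>_. {0})"
      using vsubmodule_zero[OF M] by (simp add: submodule_chain_def)
    then show ?thesis by blast
  next
    case False
    then have "submodule_chain V M 1 (\<lambda>i. if i = 0 then {0} else vcar M)"
      using vsubmodule_zero[OF M] vsubmodule_full[OF M] cvs.subspace_0[OF vertex_module_subspace[OF M]]
      by (auto simp: submodule_chain_def)
    then show ?thesis by blast
  qed
  define n where "n = (GREATEST n. \<exists>C. submodule_chain V M n C)"
  have "\<exists>C. submodule_chain V M n C"
    unfolding n_def using ex by (rule GreatestI_ex_nat[where b = d]) (use bound in blast)
  then obtain C where C: "submodule_chain V M n C" by blast
  have longest: "n' \<le> n" if "submodule_chain V M n' C'" for n' C'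
    unfolding n_def using that bound by (intro Greatest_le_nat[where b = d]) blast+
  have "W = C i \<or> W = C (Suc i)"
    if "i < n" "vsubmodule V M W" "C i \<subseteq> W" "W \<subseteq> C (Suc i)" for i W
  proof (rule ccontr)
    assume "\<not> ?thesis"
    then have "C i \<subset> W" "W \<subset> C (Suc i)" using that by auto
    then have "Suc n \<le> n" by (rule longest[OF submodule_chain_insert[OF C that(1,2)]])
    then show False by simp
  qed
  with C show ?thesis unfolding finite_length_def by blast
qed

section \<open>Length bounded by dimensions of weight spaces\<close>

theorem theorem5p3:
  fixes l :: nat
    and V :: "'v::complex_vector vertex_alg"
    and \<iota> :: "complex mat \<Rightarrow> 'v"
    and w z :: "nat \<Rightarrow> aweight \<Rightarrow> aweight"
    and \<nu> :: "nat \<Rightarrow> aweight"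
    and M :: "('v, 'm::complex_vector) vmod"
  assumes rank: "l \<ge> 5"
    and V: "simple_affine_vertex_algebra l (-1) V \<iota>"
    and cell: "bij_betw w {0..l} (left_cell (affine_gens l) (simple_refl l 0))"
    and w0: "w 0 = simple_refl l 0"
    and wi: "\<forall>i\<in>{1..l}. z i \<in> finite_weyl l \<and> w i = z i \<circ> simple_refl l 0"
    and lam: "\<forall>i\<in>{0..l}. \<nu> i = dot_act l (w i) (- Lambda0)"
    and simples: "simple_objects_are TYPE('m) l V \<iota> (\<nu> ` {0..l})"
    and M: "category_C l V \<iota> M"
  shows "finite_length V M \<and>
    vmod_length V M \<le>
      enat (\<Sum>i=0..l. cvs.dim (gen_weight_space l (underlying l (-1) V \<iota> M) (\<nu> i)))"
proof -
  have V': "affine_vertex_algebra l (-1) V \<iota>"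
    using V by (simp add: simple_affine_vertex_algebra_def)
  then interpret affine_va l "-1" V \<iota> by unfold_locales
  have Mmod: "vertex_module V M" using M by (simp add: category_C_def)
  define G where "G i = gen_weight_space l (aff M) (\<nu> i)" for i
  \<comment> \<open>The invariant that grows along chains; for the whole module it is the bound of
    the theorem.\<close>
  define dims where "dims W = (\<Sum>i=0..l. cvs.dim (W \<inter> G i))" for W
  \<comment> \<open>Finite dimensionality in the category is stated for weights in
    \<open>hdual l\<close>; truncation transfers it to \<open>\<nu> i\<close>.\<close>
  have fin: "\<exists>B. finite B \<and> G i \<subseteq> cvs.span B" for i
    using M truncate_weight_in_hdual[of l "\<nu> i"]
    unfolding category_C_def Let_def gen_weights_finite_dim_def G_def
    by (metis gen_weight_space_truncate_weight subset_refl)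
  have step: "dims A < dims B" if A: "vsubmodule V M A" and B: "vsubmodule V M B" and "A \<subset> B" for A B
  proof -
    have "\<exists>\<mu>\<in>\<nu> ` {0..l}. A \<inter> gen_weight_space l (aff M) \<mu> \<noteq> B \<inter> gen_weight_space l (aff M) \<mu>"
      by (rule simple_subquotient_between[OF M V' A B \<open>A \<subset> B\<close>])
        (use simples in \<open>simp add: simple_objects_are_def\<close>)
    then obtain i where i: "i \<in> {0..l}" "A \<inter> G i \<noteq> B \<inter> G i"
      unfolding G_def by blast
    have le: "cvs.dim (A \<inter> G j) \<le> cvs.dim (B \<inter> G j)" for j
      using fin[of j] \<open>A \<subset> B\<close> dim_mono_strict(1)[of _ "B \<inter> G j" "A \<inter> G j"] by blast
    have "cvs.subspace (A \<inter> G i)"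
      by (simp add: G_def cvs.subspace_inter vsubmodule_subspace[OF A] gen_weight_space_subspace[OF Mmod])
    then have "cvs.dim (A \<inter> G i) < cvs.dim (B \<inter> G i)"
      using fin[of i] i(2) \<open>A \<subset> B\<close> dim_mono_strict(2)[of _ "B \<inter> G i" "A \<inter> G i"] by blast
    \<comment> \<open>No summand decreases from \<open>A\<close> to \<open>B\<close>, and the one
      for the index \<open>i\<close> found above increases strictly.\<close>
    then show ?thesis
      unfolding dims_def using i(1) le by (intro sum_strict_mono_ex1) auto
  qed
  have bound: "n \<le> dims (vcar M)" if C: "submodule_chain V M n C" for n C
  proof -
    \<comment> \<open>Every strict inclusion raises the natural number \<open>dims\<close> by at
      least one; at \<open>i = n\<close> the chain has reached the whole module.\<close>
    have "i \<le> dims (C i)" if "i \<le> n" for i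
      using that
    proof (induction i)
      case (Suc i)
      then have "dims (C i) < dims (C (Suc i))"
        using C by (intro step) (auto simp: submodule_chain_def)
      with Suc show ?case by simp
    qed simp
    from this[of n] show ?thesis using C by (simp add: submodule_chain_def)
  qed
  have "vcar M \<inter> G i = G i" for i by (auto simp: G_def gen_weight_space_def underlying_def)
  then have "dims (vcar M) = (\<Sum>i=0..l. cvs.dim (gen_weight_space l (aff M) (\<nu> i)))"
    by (simp add: dims_def G_def)
  moreover have "vmod_length V M \<le> enat (dims (vcar M))"
    unfolding vmod_length_def by (rule Sup_least) (use bound in auto)
  ultimately show ?thesis
    using finite_length_if_chains_bounded[OF Mmod bound] by simp
qed

end
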